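(* Let $(G,A_k)$ be a transitive permutation group and let $\widehat G=\wr^{\infty}(G,A_k)$. Let $f,g\in\widehat G$ be finite state transformations, given by finite state initial automata. Then it is decidable whether $f$ and $g$ are equal in $\widehat G^{ab}$. That is, there is an algorithm which, given as input two finite state initial automata over $A_k$ computing elements $f,g\in\widehat G$, decides whether $f[\widehat G,\widehat G]=g[\widehat G,\widehat G]$.
   Context: Let $k\ge1$, $A_k=\{0,\dots,k-1\}$ and let $T_k$ be the rooted regular $k$-ary tree, viewed as the Cayley graph of the free monoid $A_k^*$, so that vertices are words over $A_k$, the root is the empty word $\varepsilon$, and each word $u$ is joined to $ua$ for $a\in A_k$. $\mathrm{Aut}(T_k)$ is the group of automorphisms of this rooted tree; it acts on $A_k^*$ preserving length, and is a profinite group (the pointwise stabilizers of the levels $A_k^n$ form a basis of neighbourhoods of the identity). Sections: for $f\in\mathrm{Aut}(T_k)$ and $u\in A_k^*$, the section $f_u\in\mathrm{Aut}(T_k)$ is the unique automorphism with $f(uw)=f(u)f_u(w)$ for all $w\in A_k^*$. Let $\lambda_f\in S_k=\mathrm{Sym}(A_k)$ be the permutation $a\mapsto f(a)$ of $A_k$ induced by $f$. The element $f$ is finite state if $\{f_w\mid w\in A_k^*\}$ is finite. Iterated wreath product: for a transitive permutation group $(G,A_k)$, i.e. $G\le S_k$ transitive on $A_k$, $\widehat G=\wr^\infty(G,A_k)=(G,A_k)\wr(G,A_k)\wr\cdots$ is the closed subgroup of $\mathrm{Aut}(T_k)$ consisting of all $f$ such that $\lambda_{f_w}\in G$ for every $w\in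 A_k^*$. Abelianization: for a profinite group $H$, $[H,H]$ denotes the closure of the commutator subgroup of $H$, and $H^{ab}=H/[H,H]$. It is known that $\widehat G^{ab}$ is isomorphic to the infinite direct product $G^{ab}\times G^{ab}\times\cdots$, the coset $g[\widehat G,\widehat G]$ corresponding to the sequence whose $n$-th term ($n\ge0$) is $\sum_{|w|=n}\lambda_{g_w}[G,G]$ (with $G^{ab}$ written additively, the sum over words $w\in A_k^*$ of length $n$). Automata: a finite state automaton over an alphabet $A$ is $\mathcal A=(Q,A,\delta,\lambda)$ with $Q$ a finite set of states, transition function $\delta:Q\times A\to Q$ and output function $\lambda:Q\times A\to A$. Write $q_a=\delta(q,a)$, $q(a)=\lambda(q,a)$. Each state $q$ defines a length-preserving map $q:A^*\to A^*$ by $q(\varepsilon)=\varepsilon$ and $q(au)=q(a)\,q_a(u)$ for $a\in A$, $u\in A^*$. An initial automaton is an automaton with a distinguished (initial) state; it computes the map $A^*\to A^*$ defined by that state. An element of $\mathrm{Aut}(T_k)$ is finite state if and only if it is computed by some finite state initial automaton over $A_k$. *)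

theory Defs
  imports
    "HOL-Algebra.Bij"
    "HOL-Algebra.Generated_Groups"
    "HOL-Analysis.Abstract_Topology"
    "HOL-Library.Nat_Bijection"
begin

section \<open>Automorphisms of the rooted regular tree\<close>

abbreviation words :: "nat \<Rightarrow> nat list set" where
  "words k \<equiv> lists {..<k}"

definition tree_adj :: "nat \<Rightarrow> nat list \<Rightarrow> nat list \<Rightarrow> bool" where
  "tree_adj k u v \<longleftrightarrow> (\<exists>a<k. v = u @ [a] \<or> u = v @ [a])"

text \<open>As in the library's \<open>BijGroup\<close>, tree automorphisms are extensional functions (they take the
  value \<open>undefined\<close> outside \<open>words k\<close>), so that HOL equality is equality of automorphisms.\<close>

definition tree_aut :: "nat \<Rightarrow> (nat list \<Rightarrow> nat list) monoid" where
  "tree_aut k = BijGroup (words k)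
     \<lparr>carrier := {f \<in> Bij (words k). f [] = [] \<and>
        (\<forall>u\<in>words k. \<forall>v\<in>words k. tree_adj k (f u) (f v) \<longleftrightarrow> tree_adj k u v)}\<rparr>"

definition tree_section :: "nat \<Rightarrow> (nat list \<Rightarrow> nat list) \<Rightarrow> nat list \<Rightarrow> (nat list \<Rightarrow> nat list)" where
  "tree_section k f u =
     (THE g. g \<in> carrier (tree_aut k) \<and> (\<forall>w\<in>words k. f (u @ w) = f u @ g w))"

definition root_perm :: "nat \<Rightarrow> (nat list \<Rightarrow> nat list) \<Rightarrow> (nat \<Rightarrow> nat)" where
  "root_perm k f = (\<lambda>a\<in>{..<k}. hd (f [a]))"

definition level_stab :: "nat \<Rightarrow> nat \<Rightarrow> (nat list \<Rightarrow> nat list) set" where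
  "level_stab k n =
     {f \<in> carrier (tree_aut k). \<forall>w\<in>words k. length w = n \<longrightarrow> f w = w}"

text \<open>The group topology in which the level stabilizers are a neighbourhood base of the identity.\<close>

definition tree_aut_topology :: "nat \<Rightarrow> (nat list \<Rightarrow> nat list) topology" where
  "tree_aut_topology k = topology (\<lambda>U. U \<subseteq> carrier (tree_aut k) \<and>
     (\<forall>f\<in>U. \<exists>n. f <#\<^bsub>tree_aut k\<^esub> level_stab k n \<subseteq> U))"


section \<open>Infinite iterated wreath products\<close>

definition transitive_perm_group :: "nat \<Rightarrow> (nat \<Rightarrow> nat) set \<Rightarrow> bool" where
  "transitive_perm_group k G \<longleftrightarrow>
     subgroup G (BijGroup {..<k}) \<and> (\<forall>a<k. \<forall>b<k. \<exists>p\<in>G. p a = b)"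

definition wreath :: "nat \<Rightarrow> (nat \<Rightarrow> nat) set \<Rightarrow> (nat list \<Rightarrow> nat list) monoid" where
  "wreath k G = tree_aut k
     \<lparr>carrier := {f \<in> carrier (tree_aut k).
        \<forall>w\<in>words k. root_perm k (tree_section k f w) \<in> G}\<rparr>"

definition wreath_topology :: "nat \<Rightarrow> (nat \<Rightarrow> nat) set \<Rightarrow> (nat list \<Rightarrow> nat list) topology" where
  "wreath_topology k G = subtopology (tree_aut_topology k) (carrier (wreath k G))"

definition wreath_commutator :: "nat \<Rightarrow> (nat \<Rightarrow> nat) set \<Rightarrow> (nat list \<Rightarrow> nat list) set" where
  "wreath_commutator k G =
     wreath_topology k G closure_of derived (wreath k G) (carrier (wreath k G))"


section \<open>Finite state initial automata\<close>

record 'q automaton =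
  states :: "'q set"
  trans :: "'q \<Rightarrow> nat \<Rightarrow> 'q"
  out :: "'q \<Rightarrow> nat \<Rightarrow> nat"
  init :: 'q

definition finite_initial_automaton :: "nat \<Rightarrow> 'q automaton \<Rightarrow> bool" where
  "finite_initial_automaton k A \<longleftrightarrow> finite (states A) \<and> init A \<in> states A \<and>
     (\<forall>q\<in>states A. \<forall>a<k. trans A q a \<in> states A \<and> out A q a < k)"

fun run :: "'q automaton \<Rightarrow> 'q \<Rightarrow> nat list \<Rightarrow> nat list" where
  "run A q [] = []"
| "run A q (a # u) = out A q a # run A (trans A q a) u"

definition computed :: "nat \<Rightarrow> 'q automaton \<Rightarrow> nat list \<Rightarrow> nat list" where
  "computed k A = restrict (run A (init A)) (words k)"

text \<open>For an algorithm, states are named by natural numbers. An automaton is presented by its initial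
  state followed by the list of all its transitions \<open>(q, a, q\<^sub>a, q(a))\<close>; \<open>list_encode\<close> is the standard
  computable bijection between lists of naturals and naturals. For \<open>k > 0\<close> the code determines
  the automaton up to the irrelevant values of \<open>trans\<close> and \<open>out\<close> outside \<open>states A \<times> {..<k}\<close>.\<close>

definition encode_automaton :: "nat \<Rightarrow> nat automaton \<Rightarrow> nat" where
  "encode_automaton k A = list_encode (init A #
     map (\<lambda>(q, a). list_encode [q, a, trans A q a, out A q a])
       (List.product (sorted_list_of_set (states A)) [0..<k]))"


section \<open>Algorithms\<close>

text \<open>Kleene's partial recursive functions. \<open>rec_eval r xs y\<close> says that the algorithm \<open>r\<close> halts on
  input \<open>xs\<close> with output \<open>y\<close>. In \<open>Prec f g\<close> the recursion variable is the first argument, and \<open>g\<close>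
  receives the previous value, the recursion variable and the parameters, in this order.\<close>

datatype recf = Zero | Succ | Proj nat | Comp recf "recf list" | Prec recf recf | Mu recf

inductive rec_eval :: "recf \<Rightarrow> nat list \<Rightarrow> nat \<Rightarrow> bool" where
  zero: "rec_eval Zero xs 0"
| succ: "rec_eval Succ [x] (Suc x)"
| proj: "i < length xs \<Longrightarrow> rec_eval (Proj i) xs (xs ! i)"
| comp: "list_all2 (\<lambda>g y. rec_eval g xs y) gs ys \<Longrightarrow> rec_eval f ys z \<Longrightarrow>
    rec_eval (Comp f gs) xs z"
| prec_0: "rec_eval f xs z \<Longrightarrow> rec_eval (Prec f g) (0 # xs) z"
| prec_Suc: "rec_eval (Prec f g) (n # xs) y \<Longrightarrow> rec_eval g (y # n # xs) z \<Longrightarrow>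
    rec_eval (Prec f g) (Suc n # xs) z"
| mu: "rec_eval f (n # xs) 0 \<Longrightarrow> \<forall>m<n. \<exists>y. rec_eval f (m # xs) (Suc y) \<Longrightarrow>
    rec_eval (Mu f) xs n"

text \<open>\<open>P\<close> is decidable for inputs from \<open>D\<close>, presented to the algorithm by means of \<open>enc\<close>. Nothing is
  required of the algorithm on number tuples that do not encode an element of \<open>D\<close>.\<close>

definition decidable_on :: "'a set \<Rightarrow> ('a \<Rightarrow> nat list) \<Rightarrow> ('a \<Rightarrow> bool) \<Rightarrow> bool" where
  "decidable_on D enc P \<longleftrightarrow>
     (\<exists>r. \<forall>x\<in>D. rec_eval r (enc x) (if P x then 1 else 0))"


section \<open>Well-definedness of the notions above\<close>

lemma rec_eval_deterministic: "rec_eval r xs y \<Longrightarrow> rec_eval r xs z \<Longrightarrow> y = z"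
proof (induction arbitrary: z rule: rec_eval.induct)
  case (zero xs)
  then show ?case by (auto elim: rec_eval.cases)
next
  case (succ x)
  then show ?case by (auto elim: rec_eval.cases)
next
  case (proj i xs)
  from proj(2) show ?case by (cases rule: rec_eval.cases) auto
next
  case (comp xs gs ys f z)
  from comp.prems obtain ys' where ys': "list_all2 (\<lambda>g y. rec_eval g xs y) gs ys'"
    and f: "rec_eval f ys' z"
    by (cases rule: rec_eval.cases) auto
  have "ys = ys'"
    using comp.IH(1) ys' by (auto simp: list_all2_conv_all_nth intro!: nth_equalityI)
  with f comp.IH(2) show ?case by blast
next
  case (prec_0 f xs z g)
  from prec_0.prems prec_0.IH show ?case by (cases rule: rec_eval.cases) auto
next
  case (prec_Suc f g n xs y z)
  from prec_Suc.prems prec_Suc.IH show ?case by (cases rule: rec_eval.cases) auto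
next
  case (mu f n xs)
  from mu.prems have z: "rec_eval f (z # xs) 0" "\<forall>m<z. \<exists>y. rec_eval f (m # xs) (Suc y)"
    by (cases rule: rec_eval.cases; auto)+
  have "\<not> n < z" using mu.IH(1) z(2) by fastforce
  moreover have "\<not> z < n" using mu.IH(2) z(1) by fastforce
  ultimately show ?case by simp
qed

lemma carrier_tree_aut: "carrier (tree_aut k) = {f \<in> Bij (words k). f [] = [] \<and>
    (\<forall>u\<in>words k. \<forall>v\<in>words k. tree_adj k (f u) (f v) \<longleftrightarrow> tree_adj k u v)}"
  by (simp add: tree_aut_def)

lemma tree_aut_snoc:
  assumes f: "f \<in> carrier (tree_aut k)" and "u \<in> words k" "a < k"
  shows "length (f u) = length u \<and> (\<exists>b<k. f (u @ [a]) = f u @ [b])"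
proof -
  have bij: "bij_betw f (words k) (words k)" and f0: "f [] = []"
    and adj: "\<And>u v. u \<in> words k \<Longrightarrow> v \<in> words k \<Longrightarrow> tree_adj k u v \<Longrightarrow> tree_adj k (f u) (f v)"
    using f by (auto simp: carrier_tree_aut Bij_def)
  have "length (f u) = length u \<and> (\<forall>a<k. \<exists>b<k. f (u @ [a]) = f u @ [b])"
    using \<open>u \<in> words k\<close>
  proof (induction u rule: rev_induct)
    case Nil
    have "\<exists>b<k. f [a] = [b]" if "a < k" for a
      using adj[of "[]" "[a]"] that f0 by (auto simp: tree_adj_def)
    then show ?case using f0 by simp
  next
    case (snoc c u)
    then have c: "c < k" and u: "u \<in> words k" by auto
    with snoc.IH obtain d where d: "d < k" "f (u @ [c]) = f u @ [d]" "length (f u) = length u"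
      by auto
    have "\<exists>b<k. f ((u @ [c]) @ [a]) = f (u @ [c]) @ [b]" if a: "a < k" for a
    proof -
      have w: "u @ [c] \<in> words k" "(u @ [c]) @ [a] \<in> words k" using u c a by auto
      have "tree_adj k (f (u @ [c])) (f ((u @ [c]) @ [a]))"
        using a by (intro adj w) (auto simp: tree_adj_def)
      moreover have "f ((u @ [c]) @ [a]) \<noteq> f u"
        using bij u w inj_onD[of f "words k" "(u @ [c]) @ [a]" u] unfolding bij_betw_def by fastforce
      ultimately show ?thesis using d by (auto simp: tree_adj_def)
    qed
    with d show ?case by simp
  qed
  with \<open>a < k\<close> show ?thesis by blast
qed

lemma tree_aut_length:
  assumes f: "f \<in> carrier (tree_aut k)" and u: "u \<in> words k"
  shows "length (f u) = length u"
proof (cases u rule: rev_cases)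
  case Nil
  then show ?thesis using f by (simp add: carrier_tree_aut)
next
  case (snoc v a)
  then show ?thesis using tree_aut_snoc[OF f, of v a] u by auto
qed

lemma tree_aut_prefix:
  assumes f: "f \<in> carrier (tree_aut k)" and "u \<in> words k" "w \<in> words k"
  shows "take (length u) (f (u @ w)) = f u"
  using \<open>w \<in> words k\<close>
proof (induction w rule: rev_induct)
  case Nil
  then show ?case using tree_aut_length[OF f \<open>u \<in> words k\<close>] by simp
next
  case (snoc a w)
  have uw: "u @ w \<in> words k" "a < k" using snoc.prems \<open>u \<in> words k\<close> by auto
  obtain b where "f ((u @ w) @ [a]) = f (u @ w) @ [b]"
    using tree_aut_snoc[OF f uw] by blast
  then show ?case using snoc tree_aut_length[OF f uw(1)] by simp
qed

lemma tree_adj_append: "tree_adj k (x @ u) (x @ v) \<longleftrightarrow> tree_adj k u v"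
  by (simp add: tree_adj_def)

lemma tree_section_ex1:
  assumes f: "f \<in> carrier (tree_aut k)" and u: "u \<in> words k"
  shows "\<exists>!g. g \<in> carrier (tree_aut k) \<and> (\<forall>w\<in>words k. f (u @ w) = f u @ g w)"
proof (rule ex_ex1I)
  let ?g = "\<lambda>w\<in>words k. drop (length u) (f (u @ w))"
  have bij: "bij_betw f (words k) (words k)"
    using f by (auto simp: carrier_tree_aut Bij_def)
  have eq: "f (u @ w) = f u @ ?g w" if "w \<in> words k" for w
    using tree_aut_prefix[OF f u that] that
    by (simp del: in_lists_conv_set) (metis append_take_drop_id)
  have fw: "f w \<in> words k" if "w \<in> words k" for w
    using bij that by (auto simp: bij_betw_def simp del: in_lists_conv_set)
  have uw: "u @ w \<in> words k" if "w \<in> words k" for w using u that by auto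
  have mem: "?g w \<in> words k" if "w \<in> words k" for w
    using fw[OF uw[OF that]] eq[OF that] by simp
  have "inj_on ?g (words k)"
  proof (rule inj_onI)
    fix v w assume vw: "v \<in> words k" "w \<in> words k" "?g v = ?g w"
    then have "f (u @ v) = f (u @ w)" using eq by metis
    then have "u @ v = u @ w" using bij uw[OF vw(1)] uw[OF vw(2)] by (metis bij_betw_def inj_onD)
    then show "v = w" by simp
  qed
  moreover have "\<exists>w\<in>words k. ?g w = y" if y: "y \<in> words k" for y
  proof -
    have "f u @ y \<in> words k" using fw[OF u] y by auto
    then obtain x where x: "x \<in> words k" "f x = f u @ y"
      using bij by (metis bij_betw_def imageE)
    have len: "length x = length u + length y"
      using tree_aut_length[OF f x(1)] x(2) tree_aut_length[OF f u] by simp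
    define p w where "p = take (length u) x" and "w = drop (length u) x"
    have pw: "x = p @ w" "p \<in> words k" "w \<in> words k" "length p = length u"
      using x(1) len by (auto simp: p_def w_def dest: in_set_takeD in_set_dropD)
    have "f p = f u"
      using tree_aut_prefix[OF f pw(2,3)] x(2) pw(1,4) tree_aut_length[OF f u] by simp
    then have "p = u" using bij u pw(2) by (metis bij_betw_def inj_onD)
    then have "?g w = y" using eq[OF pw(3)] x(2) pw(1) by simp
    with pw(3) show ?thesis by blast
  qed
  ultimately have "bij_betw ?g (words k) (words k)"
    using mem by (fastforce simp: bij_betw_def simp del: in_lists_conv_set restrict_apply')
  moreover have "?g [] = []" using eq[of "[]"] by simp
  moreover have "tree_adj k (?g v) (?g w) \<longleftrightarrow> tree_adj k v w"
    if vw: "v \<in> words k" "w \<in> words k" for v w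
  proof -
    have "tree_adj k (?g v) (?g w) \<longleftrightarrow> tree_adj k (f (u @ v)) (f (u @ w))"
      unfolding eq[OF vw(1)] eq[OF vw(2)] tree_adj_append ..
    also have "\<dots> \<longleftrightarrow> tree_adj k (u @ v) (u @ w)"
      using f uw[OF vw(1)] uw[OF vw(2)] by (auto simp: carrier_tree_aut)
    finally show ?thesis by (simp only: tree_adj_append)
  qed
  ultimately have "?g \<in> carrier (tree_aut k)"
    unfolding carrier_tree_aut Bij_def by (simp only: mem_Collect_eq Int_iff restrict_extensional) simp
  with eq show "\<exists>g. g \<in> carrier (tree_aut k) \<and> (\<forall>w\<in>words k. f (u @ w) = f u @ g w)" by blast
next
  fix g h
  assume g: "g \<in> carrier (tree_aut k) \<and> (\<forall>w\<in>words k. f (u @ w) = f u @ g w)"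
    and h: "h \<in> carrier (tree_aut k) \<and> (\<forall>w\<in>words k. f (u @ w) = f u @ h w)"
  then have "g \<in> extensional (words k)" "h \<in> extensional (words k)"
    by (auto simp: carrier_tree_aut Bij_def)
  then show "g = h" by (rule extensionalityI) (use g h in \<open>metis same_append_eq\<close>)
qed

lemma level_stab_antimono:
  assumes "m \<le> n"
  shows "level_stab k n \<subseteq> level_stab k m"
proof
  fix f assume "f \<in> level_stab k n"
  then have f: "f \<in> carrier (tree_aut k)" and
    fixed: "\<And>w. w \<in> words k \<Longrightarrow> length w = n \<Longrightarrow> f w = w"
    by (auto simp: level_stab_def simp del: in_lists_conv_set)
  have "f w = w" if w: "w \<in> words k" "length w = m" for w
  proof (cases "k = 0")
    case True
    then show ?thesis using f w by (simp add: carrier_tree_aut)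
  next
    case False
    let ?z = "replicate (n - m) (0::nat)"
    have z: "?z \<in> words k" using False by auto
    have "f (w @ ?z) = w @ ?z" using w z assms by (intro fixed) auto
    then show ?thesis using tree_aut_prefix[OF f w(1) z] by simp
  qed
  with f show "f \<in> level_stab k m" by (simp add: level_stab_def)
qed

lemma istopology_tree_aut:
  "istopology (\<lambda>U. U \<subseteq> carrier (tree_aut k) \<and>
     (\<forall>f\<in>U. \<exists>n. f <#\<^bsub>tree_aut k\<^esub> level_stab k n \<subseteq> U))"
  unfolding istopology_def
proof (intro conjI allI impI)
  fix S T
  assume S: "S \<subseteq> carrier (tree_aut k) \<and> (\<forall>f\<in>S. \<exists>n. f <#\<^bsub>tree_aut k\<^esub> level_stab k n \<subseteq> S)"
    and T: "T \<subseteq> carrier (tree_aut k) \<and> (\<forall>f\<in>T. \<exists>n. f <#\<^bsub>tree_aut k\<^esub> level_stab k n \<subseteq> T)"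
  show "S \<inter> T \<subseteq> carrier (tree_aut k)" using S by blast
  show "\<forall>f\<in>S \<inter> T. \<exists>n. f <#\<^bsub>tree_aut k\<^esub> level_stab k n \<subseteq> S \<inter> T"
  proof
    fix f assume "f \<in> S \<inter> T"
    then obtain m n where "f <#\<^bsub>tree_aut k\<^esub> level_stab k m \<subseteq> S"
      "f <#\<^bsub>tree_aut k\<^esub> level_stab k n \<subseteq> T" using S T by blast
    then have "f <#\<^bsub>tree_aut k\<^esub> level_stab k (max m n) \<subseteq> S \<inter> T"
      using level_stab_antimono[of m "max m n" k] level_stab_antimono[of n "max m n" k]
      unfolding l_coset_def by fastforce
    then show "\<exists>n. f <#\<^bsub>tree_aut k\<^esub> level_stab k n \<subseteq> S \<inter> T" ..
  qed
qed (blast, meson Union_iff Union_upper order_trans)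

end

theory Submission
  imports Defs "HOL-Algebra.FiniteProduct"
begin

text \<open>Write the class of \<open>f\<close> in the abelianization of \<open>G\<close> at level \<open>n\<close> as the product of the classes of
  its local permutations at the words of length \<open>n\<close>. An element of the wreath product on which all these
  products are trivial agrees on every level with a product of commutators: having been made trivial
  on level \<open>n\<close>, its local permutations there can be moved by commutators to a single vertex, where
  their product lies in the derived subgroup of \<open>G\<close>. So two elements are equal in the abelianization
  iff their products agree on all levels.

  For an automaton, the function sending each state to its product at level \<open>n + 1\<close> is
  determined by the one for level \<open>n\<close>. Only finitely many functions are possible, so this sequence
  visits all its values within an initial segment whose length is bounded in terms of the number of
  states, and it suffices to compare finitely many levels.\<close>

section \<open>Closure properties of the computable functions\<close>

text \<open>The algorithm may depend on \<open>k\<close> and \<open>G\<close>, only not on the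
  automata. Hence nothing about \<open>G\<close> has to be computed: its abelianization is a finite
  group whose multiplication is wired in as a finite table. The commutator subgroup is taken closed,
  so it is enough to approximate an element by derived elements on each level separately; the number
  of commutators used may grow with the level. A correction made on one level can disturb deeper
  ones, which is harmless because levels are treated in order of depth. For the bound, both automata
  are run as one sequence of pairs of functions, with at most |G^ab|^(|Q_A| + |Q_B|) values. Two
  separate sequences would give two unrelated return indices, whereas comparing the elements at a
  level requires the same index for both. All states have to be followed, because the product at a
  state on level n + 1 is formed from the products at its successors on level n. The code of an
  automaton is at least its number of states, so the bound is obtained from the codes without
  counting states. All searches are then bounded, and composition and primitive recursion
  suffice.\<close>

definition computable :: "nat \<Rightarrow> (nat list \<Rightarrow> nat) \<Rightarrow> bool" where
  "computable n f \<longleftrightarrow> (\<exists>r. \<forall>xs. length xs = n \<longrightarrow> rec_eval r xs (f xs))"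

lemma computable_compose:
  assumes f: "computable (length gs) f" and gs: "\<forall>g\<in>set gs. computable n g"
  shows "computable n (\<lambda>xs. f (map (\<lambda>g. g xs) gs))"
proof -
  obtain rf where rf: "\<And>xs. length xs = length gs \<Longrightarrow> rec_eval rf xs (f xs)"
    using f by (auto simp: computable_def)
  obtain R where R: "\<And>g xs. g \<in> set gs \<Longrightarrow> length xs = n \<Longrightarrow> rec_eval (R g) xs (g xs)"
    using gs unfolding computable_def by metis
  have "rec_eval (Comp rf (map R gs)) xs (f (map (\<lambda>g. g xs) gs))" if "length xs = n" for xs
    by (rule rec_eval.comp[of _ _ "map (\<lambda>g. g xs) gs"])
      (auto simp: list_all2_conv_all_nth that intro: R rf)
  then show ?thesis unfolding computable_def by blast
qed

lemma computable_cong: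
  assumes "computable n f" and "\<And>xs. length xs = n \<Longrightarrow> f xs = g xs"
  shows "computable n g"
  using assms unfolding computable_def by metis

lemma computable_compose1:
  assumes "computable 1 (\<lambda>ys. h (ys ! 0))" "computable n f"
  shows "computable n (\<lambda>xs. h (f xs))"
  using computable_compose[of "[f]" "\<lambda>ys. h (ys ! 0)" n] assms by simp

lemma computable_nth: "i < n \<Longrightarrow> computable n (\<lambda>xs. xs ! i)"
  unfolding computable_def using rec_eval.proj by blast

lemma computable_hd: "computable (Suc n) (\<lambda>xs. hd xs)"
  by (rule computable_cong[OF computable_nth[of 0]]) (auto simp: length_Suc_conv)

lemma computable_Suc:
  assumes "computable n f"
  shows "computable n (\<lambda>xs. Suc (f xs))"
proof (rule computable_compose1[OF _ assms])
  show "computable 1 (\<lambda>ys. Suc (ys ! 0))"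
    unfolding computable_def by (auto simp: length_Suc_conv intro!: exI[of _ Succ] rec_eval.succ)
qed

lemma computable_const: "computable n (\<lambda>xs. c)"
proof (induction c)
  case 0
  show ?case unfolding computable_def using rec_eval.zero by blast
qed (rule computable_Suc)

text \<open>Weakening: under a bound variable, which is kept at the head of the list, the outer
  variables sit in \<open>tl xs\<close>. The projections shifted by one reach them.\<close>

lemma computable_tl:
  assumes "computable n f"
  shows "computable (Suc n) (\<lambda>xs. f (tl xs))"
proof -
  let ?gs = "map (\<lambda>i xs. xs ! Suc i) [0..<n] :: (nat list \<Rightarrow> nat) list"
  have "computable (Suc n) (\<lambda>xs. f (map (\<lambda>g. g xs) ?gs))"
    using assms by (intro computable_compose) (auto intro: computable_nth)
  then show ?thesis
    by (rule computable_cong) (auto simp: length_Suc_conv o_def map_nth intro!: arg_cong[of _ _ f])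
qed

text \<open>The order of \<open>hd xs\<close> and \<open>hd (tl xs)\<close> is that of
  \<open>Prec\<close>, which hands over the previous value before the counter. Keeping bound
  variables at the front of the argument list makes the rules below syntax-directed, so that most
  computability proofs are mere rule application.\<close>

lemma computable_rec_nat:
  assumes b: "computable n b" and s: "computable (Suc (Suc n)) (\<lambda>xs. s (hd (tl xs)) (hd xs) (tl (tl xs)))"
    and e: "computable n e"
  shows "computable n (\<lambda>xs. rec_nat (b xs) (\<lambda>i y. s i y xs) (e xs))"
proof -
  obtain rb where rb: "\<And>xs. length xs = n \<Longrightarrow> rec_eval rb xs (b xs)"
    using b by (auto simp: computable_def)
  obtain rs where rs: "\<And>xs. length xs = Suc (Suc n) \<Longrightarrow> rec_eval rs xs (s (hd (tl xs)) (hd xs) (tl (tl xs)))"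
    using s by (auto simp: computable_def)
  have "rec_eval (Prec rb rs) (m # xs) (rec_nat (b xs) (\<lambda>i y. s i y xs) m)" if "length xs = n" for m xs
  proof (induction m)
    case 0
    show ?case using rb that by (auto intro: rec_eval.prec_0)
  next
    case (Suc m)
    show ?case using Suc rs[of "_ # m # xs"] that by (auto intro: rec_eval.prec_Suc)
  qed
  then have "computable (Suc n) (\<lambda>ys. rec_nat (b (tl ys)) (\<lambda>i y. s i y (tl ys)) (hd ys))"
    unfolding computable_def by (intro exI[of _ "Prec rb rs"]) (auto simp: length_Suc_conv)
  \<comment> \<open>Substitutes \<open>e\<close> for the recursion variable and the projections for
    the parameters, which leaves the parameter list unchanged.\<close>
  from computable_compose[of "e # map (\<lambda>i xs. xs ! i) [0..<n]" _ n, simplified, OF this]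
  have "computable n (\<lambda>xs. rec_nat (b (map ((\<lambda>g. g xs) \<circ> (\<lambda>i xs. xs ! i)) [0..<n]))
      (\<lambda>i y. s i y (map ((\<lambda>g. g xs) \<circ> (\<lambda>i xs. xs ! i)) [0..<n])) (e xs))"
    using e computable_nth by auto
  then show ?thesis
    by (rule computable_cong) (auto simp: o_def map_nth)
qed

named_theorems computable_intros

lemmas [computable_intros] = computable_hd computable_tl computable_const computable_Suc computable_rec_nat

section \<open>Arithmetic, bounded sums and bounded quantifiers\<close>

lemma computable_add [computable_intros]:
  assumes "computable n f" "computable n g"
  shows "computable n (\<lambda>xs. f xs + g xs)"
proof -
  have "computable n (\<lambda>xs. rec_nat (f xs) (\<lambda>_ y. Suc y) (g xs))"
    by (rule computable_intros assms)+
  moreover have "rec_nat a (\<lambda>_ y. Suc y) b = a + b" for a b by (induction b) auto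
  ultimately show ?thesis by simp
qed

lemma computable_mult [computable_intros]:
  assumes "computable n f" "computable n g"
  shows "computable n (\<lambda>xs. f xs * g xs)"
proof -
  have "computable n (\<lambda>xs. rec_nat 0 (\<lambda>_ y. y + f xs) (g xs))"
    by (rule computable_intros assms)+
  moreover have "rec_nat 0 (\<lambda>_ y. y + a) b = a * b" for a b :: nat by (induction b) auto
  ultimately show ?thesis by simp
qed

lemma computable_power [computable_intros]:
  assumes "computable n f" "computable n g"
  shows "computable n (\<lambda>xs. f xs ^ g xs)"
proof -
  have "computable n (\<lambda>xs. rec_nat 1 (\<lambda>_ y. y * f xs) (g xs))"
    by (rule computable_intros assms)+
  moreover have "rec_nat 1 (\<lambda>_ y. y * a) b = a ^ b" for a b :: nat by (induction b) auto
  ultimately show ?thesis by simp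
qed

lemma computable_diff [computable_intros]:
  assumes "computable n f" "computable n g"
  shows "computable n (\<lambda>xs. f xs - g xs)"
proof -
  \<comment> \<open>A recursion that returns its counter is the predecessor; iterating it gives
    truncated subtraction.\<close>
  have pred: "rec_nat 0 (\<lambda>i _. i) a = a - 1" for a :: nat by (cases a) auto
  have "computable n (\<lambda>xs. rec_nat (f xs) (\<lambda>_ y. rec_nat 0 (\<lambda>i _. i) y) (g xs))"
    by (rule computable_intros assms)+
  moreover have "rec_nat a (\<lambda>_ y. rec_nat 0 (\<lambda>i _. i) y) b = a - b" for a b :: nat
    by (induction b) (auto simp: pred)
  ultimately show ?thesis by simp
qed

lemma computable_sum [computable_intros]:
  assumes "computable n e" "computable (Suc n) (\<lambda>xs. g (hd xs) (tl xs))"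
  shows "computable n (\<lambda>xs. \<Sum>i<e xs. g i xs)"
proof -
  have "computable (Suc (Suc n)) (\<lambda>xs. hd xs + g (hd (tl xs)) (tl (tl xs)))"
    using computable_tl[OF assms(2)] by (rule computable_add[OF computable_hd])
  then have "computable n (\<lambda>xs. rec_nat 0 (\<lambda>i y. y + g i xs) (e xs))"
    by (rule computable_rec_nat[OF computable_const _ assms(1)])
  moreover have "rec_nat 0 (\<lambda>i y. y + h i) b = (\<Sum>i<b. h i)" for h :: "nat \<Rightarrow> nat" and b
    by (induction b) auto
  ultimately show ?thesis by simp
qed

lemma computable_eq [computable_intros]:
  assumes "computable n f" "computable n g"
  shows "computable n (\<lambda>xs. of_bool (f xs = g xs))"
proof -
  have "computable n (\<lambda>xs. 1 - ((f xs - g xs) + (g xs - f xs)))"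
    by (rule computable_intros assms)+
  moreover have "1 - ((a - b) + (b - a)) = of_bool (a = b)" for a b :: nat by auto
  ultimately show ?thesis by simp
qed

lemma computable_not [computable_intros]:
  assumes "computable n (\<lambda>xs. of_bool (P xs))"
  shows "computable n (\<lambda>xs. of_bool (\<not> P xs))"
proof -
  have "computable n (\<lambda>xs. 1 - of_bool (P xs))" by (rule computable_intros assms)+
  then show ?thesis by (rule computable_cong) auto
qed

lemma computable_conj [computable_intros]:
  assumes "computable n (\<lambda>xs. of_bool (P xs))" "computable n (\<lambda>xs. of_bool (Q xs))"
  shows "computable n (\<lambda>xs. of_bool (P xs \<and> Q xs))"
proof -
  have "computable n (\<lambda>xs. of_bool (P xs) * of_bool (Q xs))" by (rule computable_intros assms)+
  then show ?thesis by (simp add: of_bool_conj)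
qed

lemma computable_if [computable_intros]:
  assumes "computable n (\<lambda>xs. of_bool (P xs))" "computable n f" "computable n g"
  shows "computable n (\<lambda>xs. if P xs then f xs else g xs)"
proof -
  have "computable n (\<lambda>xs. of_bool (P xs) * f xs + (1 - of_bool (P xs)) * g xs)"
    by (rule computable_intros assms)+
  then show ?thesis by (rule computable_cong) auto
qed

lemma computable_ball [computable_intros]:
  assumes "computable n e" "computable (Suc n) (\<lambda>xs. of_bool (P (hd xs) (tl xs)))"
  shows "computable n (\<lambda>xs. of_bool (\<forall>i<e xs. P i xs))"
proof -
  have "computable n (\<lambda>xs. of_bool ((\<Sum>i<e xs. of_bool (\<not> P i xs)) = (0 :: nat)))"
    by (rule computable_intros assms)+
  then show ?thesis by (rule computable_cong) auto
qed

lemma computable_mod [computable_intros]: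
  assumes "computable n f" "computable n g"
  shows "computable n (\<lambda>xs. f xs mod g xs)"
proof -
  \<comment> \<open>A counter that is reset on reaching the modulus. For modulus 0 it is never
    reset, in accordance with \<open>a mod 0 = a\<close>.\<close>
  have "computable n (\<lambda>xs. rec_nat 0 (\<lambda>_ y. if Suc y = g xs then 0 else Suc y) (f xs))"
    by (rule computable_intros assms)+
  moreover have "rec_nat 0 (\<lambda>_ y. if Suc y = b then 0 else Suc y) a = a mod b" for a b
    by (induction a) (auto simp: mod_Suc)
  ultimately show ?thesis by simp
qed

lemma computable_div [computable_intros]:
  assumes "computable n f" "computable n g"
  shows "computable n (\<lambda>xs. f xs div g xs)"
proof -
  \<comment> \<open>Counts the multiples of the divisor passed so far. For divisor 0 none is
    counted, which gives the value 0 of \<open>a div 0\<close>.\<close>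
  have "computable n (\<lambda>xs. rec_nat 0 (\<lambda>i y. if Suc i mod g xs = 0 then Suc y else y) (f xs))"
    by (rule computable_intros assms)+
  moreover have "rec_nat 0 (\<lambda>i y. if Suc i mod b = 0 then Suc y else y) a = a div b" for a b
    by (induction a) (auto simp: div_Suc)
  ultimately show ?thesis by simp
qed

section \<open>Pairing functions and finite tables\<close>

lemma computable_prod_encode [computable_intros]:
  assumes "computable n f" "computable n g"
  shows "computable n (\<lambda>xs. prod_encode (f xs, g xs))"
proof -
  have "computable n (\<lambda>xs. (\<Sum>i<f xs + g xs. Suc i) + f xs)"
    by (rule computable_intros assms)+
  moreover have "(\<Sum>i<a. Suc i) = triangle a" for a by (induction a) auto
  ultimately show ?thesis by (simp add: prod_encode_def)
qed

text \<open>Unpairing by exhaustive search: both components are at most the code, so exactly one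
  pair in the square below \<open>Suc c\<close> has code \<open>c\<close>, and the indicator picks
  it out. This keeps decoding within bounded sums.\<close>

lemma prod_decode_conv_sum:
  "fst (prod_decode c) = (\<Sum>a<Suc c. \<Sum>b<Suc c. of_bool (prod_encode (a, b) = c) * a)"
  "snd (prod_decode c) = (\<Sum>a<Suc c. \<Sum>b<Suc c. of_bool (prod_encode (a, b) = c) * b)"
proof -
  obtain a b where c: "c = prod_encode (a, b)" by (metis prod_decode_inverse surj_pair)
  have ab: "a < Suc c" "b < Suc c" unfolding c less_Suc_eq_le by (rule le_prod_encode_1 le_prod_encode_2)+
  have 1: "of_bool (prod_encode (a', b') = c) = of_bool (a' = a) * (of_bool (b' = b) :: nat)" for a' b'
    by (simp add: c)
  show "fst (prod_decode c) = (\<Sum>a<Suc c. \<Sum>b<Suc c. of_bool (prod_encode (a, b) = c) * a)"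
    unfolding 1 mult.assoc sum_distrib_left[symmetric]
    using ab by (simp add: c of_bool_def if_distrib if_distribR sum.delta cong: if_cong del: sum.lessThan_Suc)
  show "snd (prod_decode c) = (\<Sum>a<Suc c. \<Sum>b<Suc c. of_bool (prod_encode (a, b) = c) * b)"
    unfolding 1 mult.assoc sum_distrib_left[symmetric]
    using ab by (simp add: c of_bool_def if_distrib if_distribR sum.delta cong: if_cong del: sum.lessThan_Suc)
qed

lemma computable_fst_prod_decode [computable_intros]:
  assumes "computable n f"
  shows "computable n (\<lambda>xs. fst (prod_decode (f xs)))"
  unfolding prod_decode_conv_sum by (rule computable_intros assms)+

lemma computable_snd_prod_decode [computable_intros]:
  assumes "computable n f"
  shows "computable n (\<lambda>xs. snd (prod_decode (f xs)))"
  unfolding prod_decode_conv_sum by (rule computable_intros assms)+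

text \<open>One case distinction per entry of the table, however the table came about. Through this
  lemma the structure of \<open>G\<close> enters the algorithm.\<close>

lemma computable_finite_support:
  assumes "finite {i. T i \<noteq> 0}" "computable n f"
  shows "computable n (\<lambda>xs. T (f xs))"
  using assms(1)
proof (induction "{i. T i \<noteq> 0}" arbitrary: T rule: finite_induct)
  case empty
  then have "T = (\<lambda>_. 0)" by auto
  then show ?case by (simp add: computable_const)
next
  case (insert j S)
  have "S = {i. (T(j := 0)) i \<noteq> 0}" using insert.hyps(2,4) by auto
  then have "computable n (\<lambda>xs. (T(j := 0)) (f xs))" by (rule insert.hyps(3))
  then have "computable n (\<lambda>xs. if f xs = j then T j else (T(j := 0)) (f xs))"
    by (rule computable_if[OF computable_eq[OF assms(2) computable_const] computable_const])
  then show ?case by (rule computable_cong) auto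
qed

section \<open>Tree automorphisms and their local permutations\<close>

declare in_listsD [rule del] in_listsI [rule del]

definition level :: "nat \<Rightarrow> nat \<Rightarrow> nat list set" where
  "level k n = {w \<in> words k. length w = n}"

lemma finite_level: "finite (level k n)"
  using finite_lists_length_eq[of "{..<k}" n]
  by (simp add: level_def lists_eq_set subset_code(1) Ball_def subset_iff)

text \<open>Reads the root permutation of the section at \<open>w\<close> off the children of
  \<open>w\<close>, bypassing the definite description in \<open>tree_section\<close>;
  \<open>root_perm_tree_section\<close> links the two.\<close>

definition local_perm :: "nat \<Rightarrow> (nat list \<Rightarrow> nat list) \<Rightarrow> nat list \<Rightarrow> nat \<Rightarrow> nat" where
  "local_perm k f w = (\<lambda>a\<in>{..<k}. last (f (w @ [a])))"

lemma tree_aut_bij: "f \<in> carrier (tree_aut k) \<Longrightarrow> bij_betw f (words k) (words k)"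
  by (simp add: carrier_tree_aut Bij_def)

lemma tree_aut_ext: "f \<in> carrier (tree_aut k) \<Longrightarrow> f \<in> extensional (words k)"
  by (simp add: carrier_tree_aut Bij_def)

lemma tree_aut_Nil: "f \<in> carrier (tree_aut k) \<Longrightarrow> f [] = []"
  by (simp add: carrier_tree_aut)

lemma tree_aut_words: "f \<in> carrier (tree_aut k) \<Longrightarrow> w \<in> words k \<Longrightarrow> f w \<in> words k"
  using tree_aut_bij bij_betwE by blast

lemma tree_aut_level: "f \<in> carrier (tree_aut k) \<Longrightarrow> w \<in> level k n \<Longrightarrow> f w \<in> level k n"
  by (simp add: level_def tree_aut_words tree_aut_length)

lemma tree_aut_bij_level:
  assumes "f \<in> carrier (tree_aut k)"
  shows "bij_betw f (level k n) (level k n)"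
proof -
  have "inj_on f (level k n)"
    using tree_aut_bij[OF assms] by (auto simp: level_def bij_betw_def inj_on_def)
  moreover have "f ` level k n \<subseteq> level k n" using tree_aut_level[OF assms] by blast
  ultimately show ?thesis
    using endo_inj_surj[OF finite_level] by (simp add: bij_betw_def)
qed

lemma local_perm_less:
  assumes "f \<in> carrier (tree_aut k)" "w \<in> words k" "a < k"
  shows "local_perm k f w a < k"
  using tree_aut_snoc[OF assms] assms(3) by (auto simp: local_perm_def)

lemma tree_aut_snoc_local_perm:
  assumes "f \<in> carrier (tree_aut k)" "w \<in> words k" "a < k"
  shows "f (w @ [a]) = f w @ [local_perm k f w a]"
  using tree_aut_snoc[OF assms] assms(3) by (auto simp: local_perm_def)

lemma root_perm_tree_section:
  assumes f: "f \<in> carrier (tree_aut k)" and w: "w \<in> words k"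
  shows "root_perm k (tree_section k f w) = local_perm k f w"
proof
  fix a
  have sec: "f (w @ u) = f w @ tree_section k f w u" if "u \<in> words k" for u
    using theI'[OF tree_section_ex1[OF f w]] that by (auto simp: tree_section_def)
  show "root_perm k (tree_section k f w) a = local_perm k f w a"
  proof (cases "a < k")
    case True
    then show ?thesis
      using sec[of "[a]"] tree_aut_snoc_local_perm[OF f w True]
      by (simp add: root_perm_def) (metis list.sel(1))
  qed (simp add: root_perm_def local_perm_def)
qed

lemma local_perm_Bij:
  assumes f: "f \<in> carrier (tree_aut k)" and w: "w \<in> words k"
  shows "local_perm k f w \<in> Bij {..<k}"
proof -
  have "inj_on (local_perm k f w) {..<k}"
  proof (rule inj_onI)
    fix a b assume ab: "a \<in> {..<k}" "b \<in> {..<k}" "local_perm k f w a = local_perm k f w b"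
    then have "f (w @ [a]) = f (w @ [b])" using tree_aut_snoc_local_perm[OF f w] by simp
    then show "a = b"
      using tree_aut_bij[OF f] w ab by (auto simp: bij_betw_def dest: inj_onD[of f "words k" "w @ [a]" "w @ [b]"])
  qed
  moreover have "local_perm k f w ` {..<k} \<subseteq> {..<k}"
    using local_perm_less[OF f w] by auto
  ultimately have "bij_betw (local_perm k f w) {..<k} {..<k}"
    using endo_inj_surj[of "{..<k}"] by (simp add: bij_betw_def)
  then show ?thesis by (simp add: Bij_def local_perm_def)
qed

text \<open>The image of a word is built letter by letter from the local permutations at its proper
  prefixes, so those at depth below \<open>n\<close> determine the action down to level
  \<open>n\<close>.\<close>

lemma tree_aut_eq_on_level:
  assumes f: "f \<in> carrier (tree_aut k)" and g: "g \<in> carrier (tree_aut k)"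
    and eq: "\<And>w. w \<in> words k \<Longrightarrow> length w < n \<Longrightarrow> local_perm k f w = local_perm k g w"
  shows "u \<in> words k \<Longrightarrow> length u \<le> n \<Longrightarrow> f u = g u"
proof (induction u rule: rev_induct)
  case Nil
  show ?case using f g by (simp add: tree_aut_Nil)
next
  case (snoc a u)
  then show ?case
    using tree_aut_snoc_local_perm[OF f, of u a] tree_aut_snoc_local_perm[OF g, of u a] eq[of u] by auto
qed

lemma tree_aut_eqI:
  assumes f: "f \<in> carrier (tree_aut k)" and g: "g \<in> carrier (tree_aut k)"
    and eq: "\<And>w. w \<in> words k \<Longrightarrow> local_perm k f w = local_perm k g w"
  shows "f = g"
  by (rule extensionalityI[OF tree_aut_ext[OF f] tree_aut_ext[OF g]])
    (use tree_aut_eq_on_level[OF f g eq] in blast)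

lemma BijGroup_simps:
  "carrier (BijGroup S) = Bij S"
  "\<one>\<^bsub>BijGroup S\<^esub> = (\<lambda>x\<in>S. x)"
  "f \<in> Bij S \<Longrightarrow> g \<in> Bij S \<Longrightarrow> f \<otimes>\<^bsub>BijGroup S\<^esub> g = compose S f g"
  by (simp_all add: BijGroup_def)

lemma subgroup_tree_aut: "subgroup (carrier (tree_aut k)) (BijGroup (words k))"
proof (rule group.subgroupI[OF group_BijGroup])
  show "carrier (tree_aut k) \<subseteq> carrier (BijGroup (words k))"
    by (auto simp: carrier_tree_aut BijGroup_simps)
  have "(\<lambda>w\<in>words k. w) \<in> carrier (tree_aut k)" by (simp add: carrier_tree_aut id_Bij)
  then show "carrier (tree_aut k) \<noteq> {}" by blast
next
  fix f assume f: "f \<in> carrier (tree_aut k)"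
  then have fB: "f \<in> Bij (words k)" by (simp add: carrier_tree_aut)
  let ?h = "\<lambda>x\<in>words k. inv_into (words k) f x"
  have img: "f ` words k = words k" using tree_aut_bij[OF f] by (simp add: bij_betw_def)
  have hw: "?h w \<in> words k" "f (?h w) = w" if "w \<in> words k" for w
    using that img by (simp_all add: inv_into_into f_inv_into_f)
  have "?h \<in> Bij (words k)" using restrict_inv_into_Bij[OF fB] .
  moreover have "?h [] = []"
    using inv_into_f_f[of f "words k" "[]"] tree_aut_bij[OF f] tree_aut_Nil[OF f] by (simp add: bij_betw_def)
  moreover have "tree_adj k (?h u) (?h v) \<longleftrightarrow> tree_adj k u v" if "u \<in> words k" "v \<in> words k" for u v
    using f hw[OF that(1)] hw[OF that(2)] unfolding carrier_tree_aut mem_Collect_eq by metis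
  ultimately have "?h \<in> carrier (tree_aut k)" unfolding carrier_tree_aut by blast
  then show "inv\<^bsub>BijGroup (words k)\<^esub> f \<in> carrier (tree_aut k)" by (simp add: inv_BijGroup[OF fB])
next
  fix f g assume fg: "f \<in> carrier (tree_aut k)" "g \<in> carrier (tree_aut k)"
  have "compose (words k) f g \<in> carrier (tree_aut k)"
    using fg compose_Bij[of f "words k" g] tree_aut_words[OF fg(2)]
    by (simp add: carrier_tree_aut compose_def)
  then show "f \<otimes>\<^bsub>BijGroup (words k)\<^esub> g \<in> carrier (tree_aut k)"
    using fg by (simp add: BijGroup_simps carrier_tree_aut)
qed

lemma group_tree_aut: "group (tree_aut k)"
  using group.subgroup_imp_group[OF group_BijGroup subgroup_tree_aut] by (simp add: tree_aut_def)

lemma mult_tree_aut: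
  "f \<in> carrier (tree_aut k) \<Longrightarrow> g \<in> carrier (tree_aut k) \<Longrightarrow> f \<otimes>\<^bsub>tree_aut k\<^esub> g = compose (words k) f g"
  by (simp add: tree_aut_def BijGroup_def)

lemma mult_tree_aut_apply:
  "f \<in> carrier (tree_aut k) \<Longrightarrow> g \<in> carrier (tree_aut k) \<Longrightarrow> w \<in> words k \<Longrightarrow> (f \<otimes>\<^bsub>tree_aut k\<^esub> g) w = f (g w)"
  by (simp add: mult_tree_aut compose_def)

lemma one_tree_aut: "\<one>\<^bsub>tree_aut k\<^esub> = (\<lambda>w\<in>words k. w)"
  by (simp add: tree_aut_def BijGroup_def)

text \<open>The cocycle rule: \<open>g\<close> acts first and carries \<open>w\<close> to
  \<open>g w\<close>, so the label of \<open>f\<close> is taken there and not at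
  \<open>w\<close>.\<close>

lemma local_perm_mult:
  assumes f: "f \<in> carrier (tree_aut k)" and g: "g \<in> carrier (tree_aut k)" and w: "w \<in> words k"
  shows "local_perm k (f \<otimes>\<^bsub>tree_aut k\<^esub> g) w =
    local_perm k f (g w) \<otimes>\<^bsub>BijGroup {..<k}\<^esub> local_perm k g w"
proof -
  have gw: "g w \<in> words k" by (rule tree_aut_words[OF g w])
  have "local_perm k (f \<otimes>\<^bsub>tree_aut k\<^esub> g) w a = compose {..<k} (local_perm k f (g w)) (local_perm k g w) a" for a
  proof (cases "a < k")
    case True
    with w have wa: "w @ [a] \<in> words k" by simp
    have "(f \<otimes>\<^bsub>tree_aut k\<^esub> g) (w @ [a]) = f (g w) @ [local_perm k f (g w) (local_perm k g w a)]"
      using tree_aut_snoc_local_perm[OF g w True]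
        tree_aut_snoc_local_perm[OF f gw local_perm_less[OF g w True]]
      by (simp add: mult_tree_aut_apply[OF f g wa])
    then show ?thesis using True by (simp add: local_perm_def[of k "f \<otimes>\<^bsub>tree_aut k\<^esub> g"] compose_def)
  qed (simp add: local_perm_def compose_def)
  then show ?thesis
    by (simp add: BijGroup_simps local_perm_Bij f g w gw ext)
qed

lemma local_perm_one: "w \<in> words k \<Longrightarrow> local_perm k \<one>\<^bsub>tree_aut k\<^esub> w = \<one>\<^bsub>BijGroup {..<k}\<^esub>"
  by (auto simp: local_perm_def one_tree_aut BijGroup_simps)

section \<open>Automorphisms with prescribed local permutations\<close>

fun portrait_act :: "(nat list \<Rightarrow> nat \<Rightarrow> nat) \<Rightarrow> nat list \<Rightarrow> nat list" where
  "portrait_act P [] = []"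
| "portrait_act P (a # u) = P [] a # portrait_act (\<lambda>v. P (a # v)) u"

definition portrait_aut :: "nat \<Rightarrow> (nat list \<Rightarrow> nat \<Rightarrow> nat) \<Rightarrow> nat list \<Rightarrow> nat list" where
  "portrait_aut k P = restrict (portrait_act P) (words k)"

lemma portrait_act_snoc: "portrait_act P (u @ [a]) = portrait_act P u @ [P u a]"
  by (induction u arbitrary: P) auto

lemma length_portrait_act [simp]: "length (portrait_act P u) = length u"
  by (induction u arbitrary: P) auto

lemma Bij_lessThan_less: "p \<in> Bij {..<k} \<Longrightarrow> a < k \<Longrightarrow> p a < (k :: nat)"
  using Bij_imp_funcset by fastforce

text \<open>There are infinitely many words in general, so injectivity alone does not suffice;
  preimages are built from the first letter by inverting \<open>P []\<close>. All three inductions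
  generalise \<open>P\<close>, because passing to a subtree shifts the portrait.\<close>

lemma portrait_act_bij:
  assumes "\<And>w. w \<in> words k \<Longrightarrow> P w \<in> Bij {..<k}"
  shows "bij_betw (portrait_act P) (words k) (words k)"
proof -
  have mem: "portrait_act P u \<in> words k" if "\<And>w. w \<in> words k \<Longrightarrow> P w \<in> Bij {..<k}" "u \<in> words k" for P u
    using that
  proof (induction u arbitrary: P)
    case (Cons a u)
    then have "portrait_act (\<lambda>v. P (a # v)) u \<in> words k" by (intro Cons.IH) simp_all
    with Cons.prems show ?case by (simp add: Bij_lessThan_less)
  qed simp
  have inj: "u = v" if "\<And>w. w \<in> words k \<Longrightarrow> P w \<in> Bij {..<k}" "u \<in> words k" "v \<in> words k"
    "portrait_act P u = portrait_act P v" for P u v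
    using that
  proof (induction u arbitrary: P v)
    case Nil
    then show ?case using length_portrait_act[of P v] by simp
  next
    case (Cons a u)
    obtain b v' where v: "v = b # v'" using Cons.prems(4) length_portrait_act[of P v] by (cases v) auto
    have "inj_on (P []) {..<k}" using Cons.prems(1)[of "[]"] by (simp add: Bij_def bij_betw_def)
    then have "a = b" using Cons.prems v by (auto dest: inj_onD)
    moreover have "u = v'"
      using Cons.prems v \<open>a = b\<close> by (intro Cons.IH[of "\<lambda>w. P (a # w)" v']) auto
    ultimately show ?case using v by simp
  qed
  have surj: "\<exists>u\<in>words k. portrait_act P u = y"
    if "\<And>w. w \<in> words k \<Longrightarrow> P w \<in> Bij {..<k}" "y \<in> words k" for P y
    using that
  proof (induction y arbitrary: P)
    case Nil
    then show ?case by (intro bexI[of _ "[]"]) auto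
  next
    case (Cons b y)
    have "P [] ` {..<k} = {..<k}" using Cons.prems(1)[of "[]"] by (simp add: Bij_def bij_betw_def)
    moreover have "b \<in> {..<k}" using Cons.prems(2) by simp
    ultimately obtain a where a: "a < k" "P [] a = b" by (metis imageE lessThan_iff)
    then obtain u where "u \<in> words k" "portrait_act (\<lambda>w. P (a # w)) u = y"
      using Cons.IH[of "\<lambda>w. P (a # w)"] Cons.prems by auto
    then show ?case using a by (intro bexI[of _ "a # u"]) auto
  qed
  have "inj_on (portrait_act P) (words k)"
    by (rule inj_onI) (rule inj[of P, rotated 1], assumption+, rule assms)
  moreover have "portrait_act P u \<in> words k" if "u \<in> words k" for u
    by (rule mem[OF _ that], rule assms)
  moreover have "\<exists>u\<in>words k. portrait_act P u = y" if "y \<in> words k" for y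
    by (rule surj[OF _ that], rule assms)
  ultimately have "portrait_act P ` words k = words k" by blast
  with \<open>inj_on (portrait_act P) (words k)\<close> show ?thesis by (simp add: bij_betw_def)
qed

lemma portrait_aut_in_tree_aut:
  assumes P: "\<And>w. w \<in> words k \<Longrightarrow> P w \<in> Bij {..<k}"
  shows "portrait_aut k P \<in> carrier (tree_aut k)"
proof -
  have bij: "bij_betw (portrait_act P) (words k) (words k)" by (rule portrait_act_bij[OF P])
  then have "portrait_aut k P \<in> Bij (words k)"
    by (simp add: Bij_def portrait_aut_def bij_betw_restrict_eq)
  \<comment> \<open>Adjacency is the symmetric closure of the child relation, so it suffices that
    the latter is preserved and reflected. Reflection rests on injectivity, applied to the
    parents.\<close>
  moreover have child: "(\<exists>b<k. portrait_act P v = portrait_act P u @ [b]) \<longleftrightarrow> (\<exists>a<k. v = u @ [a])"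
    if u: "u \<in> words k" and v: "v \<in> words k" for u v
  proof
    assume "\<exists>a<k. v = u @ [a]"
    then show "\<exists>b<k. portrait_act P v = portrait_act P u @ [b]"
      using P[OF u] by (auto simp: portrait_act_snoc Bij_lessThan_less)
  next
    assume "\<exists>b<k. portrait_act P v = portrait_act P u @ [b]"
    then obtain b where b: "portrait_act P v = portrait_act P u @ [b]" by blast
    then have "length v = Suc (length u)"
      using length_portrait_act[of P v] length_portrait_act[of P u] by simp
    then obtain v' a where v': "v = v' @ [a]" by (cases v rule: rev_cases) auto
    then have "portrait_act P v' = portrait_act P u" using b by (simp add: portrait_act_snoc)
    then have "v' = u" using bij u v v' by (auto simp: bij_betw_def dest: inj_onD)
    then show "\<exists>a<k. v = u @ [a]" using v v' by auto
  qed
  ultimately show ?thesis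
    unfolding carrier_tree_aut tree_adj_def ex_disj_distrib conj_disj_distribL
    by (auto simp: portrait_aut_def)
qed

lemma local_perm_portrait_aut:
  assumes "\<And>w. w \<in> words k \<Longrightarrow> P w \<in> Bij {..<k}" "w \<in> words k"
  shows "local_perm k (portrait_aut k P) w = P w"
proof
  fix a
  show "local_perm k (portrait_aut k P) w a = P w a"
    using assms(1)[OF assms(2)] assms(2) Bij_imp_extensional[of "P w" "{..<k}"]
    by (cases "a < k") (auto simp: local_perm_def portrait_aut_def portrait_act_snoc extensional_def)
qed

section \<open>The abelianization of the iterated wreath product\<close>

locale transitive_wreath =
  fixes k :: nat and G :: "(nat \<Rightarrow> nat) set"
  assumes perm_group: "transitive_perm_group k G"
begin

definition base :: "(nat \<Rightarrow> nat) monoid" where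
  "base = BijGroup {..<k}\<lparr>carrier := G\<rparr>"

definition base_ab :: "(nat \<Rightarrow> nat) set monoid" where
  "base_ab = base Mod derived base (carrier base)"

text \<open>The default value outside \<open>G\<close> puts every value into \<open>base_ab\<close>,
  so that products of classes need no membership conditions. It matters later for states of an
  automaton whose outputs do not lie in \<open>G\<close>.\<close>

definition base_class :: "(nat \<Rightarrow> nat) \<Rightarrow> (nat \<Rightarrow> nat) set" where
  "base_class p = (if p \<in> G then derived base (carrier base) #>\<^bsub>base\<^esub> p else \<one>\<^bsub>base_ab\<^esub>)"

definition level_sum :: "nat \<Rightarrow> (nat list \<Rightarrow> nat list) \<Rightarrow> (nat \<Rightarrow> nat) set" where
  "level_sum n f = finprod base_ab (\<lambda>w. base_class (local_perm k f w)) (level k n)"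

lemma subgroup_base: "subgroup G (BijGroup {..<k})"
  using perm_group by (simp add: transitive_perm_group_def)

lemma base_subset: "p \<in> G \<Longrightarrow> p \<in> Bij {..<k}"
  using subgroup.subset[OF subgroup_base] by (auto simp: BijGroup_simps)

lemma carrier_base [simp]: "carrier base = G"
  by (simp add: base_def)

lemma mult_base [simp]: "x \<otimes>\<^bsub>base\<^esub> y = x \<otimes>\<^bsub>BijGroup {..<k}\<^esub> y"
  by (simp add: base_def)

lemma one_base [simp]: "\<one>\<^bsub>base\<^esub> = \<one>\<^bsub>BijGroup {..<k}\<^esub>"
  by (simp add: base_def)

sublocale perms: group "BijGroup {..<k}"
  by (rule group_BijGroup)

sublocale base: group base
  unfolding base_def by (rule perms.subgroup_imp_group[OF subgroup_base])

sublocale base_derived: normal "derived base (carrier base)" base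
  by (rule base.derived_self_is_normal)

sublocale base_ab: comm_group base_ab
  unfolding base_ab_def by (rule base.derived_quot_is_comm_group)

lemma finite_base: "finite G"
proof (rule finite_subset)
  show "G \<subseteq> {..<k} \<rightarrow>\<^sub>E {..<k}"
    by (auto simp only: PiE_def intro!: base_subset Bij_imp_funcset Bij_imp_extensional)
qed (simp add: finite_PiE)

lemma carrier_base_ab: "carrier base_ab = base_class ` G"
  unfolding base_ab_def carrier_FactGroup base_class_def by auto

lemma finite_base_ab: "finite (carrier base_ab)"
  by (simp add: carrier_base_ab finite_base)

lemma base_class_closed [simp]: "base_class p \<in> carrier base_ab"
proof (cases "p \<in> G")
  case False
  then show ?thesis by (simp add: base_class_def)
qed (simp add: carrier_base_ab)

lemma base_class_mult:
  "p \<in> G \<Longrightarrow> q \<in> G \<Longrightarrow> base_class (p \<otimes>\<^bsub>BijGroup {..<k}\<^esub> q) = base_class p \<otimes>\<^bsub>base_ab\<^esub> base_class q"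
  using base_derived.r_coset_hom_Mod base.m_closed[of p q]
  by (auto simp: base_class_def hom_def base_ab_def)

lemma base_class_one: "base_class \<one>\<^bsub>BijGroup {..<k}\<^esub> = \<one>\<^bsub>base_ab\<^esub>"
  using base.coset_mult_one[of "derived base (carrier base)"] base_derived.subset
  by (auto simp: base_class_def base_ab_def)

lemma base_class_eq_one:
  assumes "p \<in> G" "base_class p = \<one>\<^bsub>base_ab\<^esub>"
  shows "p \<in> derived base (carrier base)"
  using base.rcos_self[of p "derived base (carrier base)"] base_derived.subgroup_axioms assms
  by (simp add: base_class_def base_ab_def)

sublocale tree: group "tree_aut k"
  by (rule group_tree_aut)

lemma carrier_wreath:
  "carrier (wreath k G) = {f \<in> carrier (tree_aut k). \<forall>w\<in>words k. local_perm k f w \<in> G}"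
  unfolding wreath_def by (auto simp: root_perm_tree_section)

lemma wreath_simps [simp]:
  "x \<otimes>\<^bsub>wreath k G\<^esub> y = x \<otimes>\<^bsub>tree_aut k\<^esub> y" "\<one>\<^bsub>wreath k G\<^esub> = \<one>\<^bsub>tree_aut k\<^esub>"
  by (simp_all add: wreath_def)

lemma wreath_tree_aut: "f \<in> carrier (wreath k G) \<Longrightarrow> f \<in> carrier (tree_aut k)"
  by (simp add: carrier_wreath)

lemma local_perm_wreath: "f \<in> carrier (wreath k G) \<Longrightarrow> w \<in> words k \<Longrightarrow> local_perm k f w \<in> G"
  by (simp add: carrier_wreath)

lemma local_perm_inv:
  assumes f: "f \<in> carrier (tree_aut k)" and w: "w \<in> words k"
  shows "local_perm k (inv\<^bsub>tree_aut k\<^esub> f) w =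
    inv\<^bsub>BijGroup {..<k}\<^esub> (local_perm k f ((inv\<^bsub>tree_aut k\<^esub> f) w))"
proof -
  let ?i = "inv\<^bsub>tree_aut k\<^esub> f"
  have i: "?i \<in> carrier (tree_aut k)" using f by simp
  have "local_perm k f (?i w) \<otimes>\<^bsub>BijGroup {..<k}\<^esub> local_perm k ?i w = \<one>\<^bsub>BijGroup {..<k}\<^esub>"
    using local_perm_mult[OF f i w] f local_perm_one[OF w] by simp
  then show ?thesis
    using local_perm_Bij[OF f tree_aut_words[OF i w]] local_perm_Bij[OF i w]
    by (metis BijGroup_simps(1) perms.inv_equality perms.inv_inv)
qed

lemma subgroup_wreath: "subgroup (carrier (wreath k G)) (tree_aut k)"
proof (rule tree.subgroupI)
  have "\<one>\<^bsub>tree_aut k\<^esub> \<in> carrier (wreath k G)"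
    using subgroup.one_closed[OF subgroup_base] by (simp add: carrier_wreath local_perm_one)
  then show "carrier (wreath k G) \<noteq> {}" by blast
next
  fix f assume f: "f \<in> carrier (wreath k G)"
  then show "inv\<^bsub>tree_aut k\<^esub> f \<in> carrier (wreath k G)"
    using subgroup.m_inv_closed[OF subgroup_base] tree_aut_words[of "inv\<^bsub>tree_aut k\<^esub> f"]
    by (simp add: carrier_wreath local_perm_inv)
next
  fix f g assume "f \<in> carrier (wreath k G)" "g \<in> carrier (wreath k G)"
  then show "f \<otimes>\<^bsub>tree_aut k\<^esub> g \<in> carrier (wreath k G)"
    using subgroup.m_closed[OF subgroup_base] tree_aut_words[of g]
    by (simp add: carrier_wreath local_perm_mult)
qed (auto simp: carrier_wreath)

lemma wreath_eq: "wreath k G = tree_aut k\<lparr>carrier := carrier (wreath k G)\<rparr>"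
  by (simp add: wreath_def)

sublocale wreath: group "wreath k G"
  using tree.subgroup_imp_group[OF subgroup_wreath] by (simp flip: wreath_eq)

lemma inv_wreath: "f \<in> carrier (wreath k G) \<Longrightarrow> inv\<^bsub>wreath k G\<^esub> f = inv\<^bsub>tree_aut k\<^esub> f"
  using tree.m_inv_consistent[OF subgroup_wreath] by (simp flip: wreath_eq)

section \<open>Level products as homomorphisms to the abelianization of \<open>G\<close>\<close>

lemma level_words: "w \<in> level k n \<Longrightarrow> w \<in> words k"
  by (simp add: level_def)

lemma level_sum_closed: "level_sum n f \<in> carrier base_ab"
  unfolding level_sum_def by (rule base_ab.finprod_closed) simp

text \<open>By the cocycle rule the factors of \<open>f\<close> appear at the vertices
  \<open>g w\<close>. As \<open>g\<close> permutes the level and the target is commutative,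
  reindexing restores the product for \<open>f\<close>.\<close>

lemma level_sum_mult:
  assumes f: "f \<in> carrier (wreath k G)" and g: "g \<in> carrier (wreath k G)"
  shows "level_sum n (f \<otimes>\<^bsub>tree_aut k\<^esub> g) = level_sum n f \<otimes>\<^bsub>base_ab\<^esub> level_sum n g"
proof -
  note ft = wreath_tree_aut[OF f] and gt = wreath_tree_aut[OF g]
  have "level_sum n (f \<otimes>\<^bsub>tree_aut k\<^esub> g) = finprod base_ab
      (\<lambda>w. base_class (local_perm k f (g w)) \<otimes>\<^bsub>base_ab\<^esub> base_class (local_perm k g w)) (level k n)"
    unfolding level_sum_def
    by (intro base_ab.finprod_cong' refl funcsetI)
      (simp_all add: local_perm_mult ft gt level_words base_class_mult local_perm_wreath f g tree_aut_words)
  also have "\<dots> = finprod base_ab (\<lambda>w. base_class (local_perm k f (g w))) (level k n) \<otimes>\<^bsub>base_ab\<^esub> level_sum n g"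
    unfolding level_sum_def by (intro base_ab.finprod_multf) simp_all
  also have "finprod base_ab (\<lambda>w. base_class (local_perm k f (g w))) (level k n) = level_sum n f"
    using tree_aut_bij_level[OF gt, of n]
      base_ab.finprod_reindex[of "\<lambda>w. base_class (local_perm k f w)" g "level k n"]
    by (simp add: level_sum_def bij_betw_def)
  finally show ?thesis .
qed

lemma group_hom_level_sum: "group_hom (wreath k G) base_ab (level_sum n)"
  by (intro group_hom.intro group_hom_axioms.intro wreath.group_axioms base_ab.group_axioms homI)
    (simp_all add: level_sum_closed level_sum_mult)

lemma derived_wreath_subset: "derived (wreath k G) (carrier (wreath k G)) \<subseteq> carrier (wreath k G)"
  by (rule wreath.derived_in_carrier) simp

lemma level_sum_derived:
  assumes "d \<in> derived (wreath k G) (carrier (wreath k G))"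
  shows "level_sum n d = \<one>\<^bsub>base_ab\<^esub>"
proof -
  interpret group_hom "wreath k G" base_ab "level_sum n" by (rule group_hom_level_sum)
  have "level_sum n ` derived (wreath k G) (carrier (wreath k G)) = {\<one>\<^bsub>base_ab\<^esub>}"
    unfolding derived_img[OF subset_refl, symmetric]
    by (rule base_ab.derived_eq_singleton) (auto simp: level_sum_closed)
  then show ?thesis using assms by blast
qed

section \<open>Automorphisms with a single nontrivial local permutation\<close>

definition spark :: "nat list \<Rightarrow> (nat \<Rightarrow> nat) \<Rightarrow> nat list \<Rightarrow> nat list" where
  "spark w p = portrait_aut k (\<lambda>v. if v = w then p else \<one>\<^bsub>BijGroup {..<k}\<^esub>)"

lemma local_perm_spark:
  assumes "p \<in> G" "v \<in> words k"
  shows "local_perm k (spark w p) v = (if v = w then p else \<one>\<^bsub>BijGroup {..<k}\<^esub>)"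
  unfolding spark_def
  by (rule local_perm_portrait_aut) (use assms base_subset perms.one_closed in \<open>auto simp: BijGroup_simps(1)\<close>)

lemma spark_closed:
  assumes "p \<in> G"
  shows "spark w p \<in> carrier (wreath k G)"
proof -
  have "spark w p \<in> carrier (tree_aut k)"
    unfolding spark_def
    by (rule portrait_aut_in_tree_aut) (use assms base_subset perms.one_closed in \<open>auto simp: BijGroup_simps(1)\<close>)
  then show ?thesis
    using assms subgroup.one_closed[OF subgroup_base] by (simp add: carrier_wreath local_perm_spark)
qed

lemma spark_fixes:
  assumes p: "p \<in> G" and u: "u \<in> words k" "length u \<le> length w"
  shows "spark w p u = u"
proof -
  have "spark w p u = \<one>\<^bsub>tree_aut k\<^esub> u"
    by (rule tree_aut_eq_on_level[where k = k and n = "length w"])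
      (use wreath_tree_aut[OF spark_closed[OF p]] u in \<open>auto simp: local_perm_spark p local_perm_one\<close>)
  then show ?thesis by (simp add: one_tree_aut u)
qed

lemma spark_mult:
  assumes p: "p \<in> G" "q \<in> G" and w: "w \<in> words k"
  shows "spark w (p \<otimes>\<^bsub>BijGroup {..<k}\<^esub> q) = spark w p \<otimes>\<^bsub>tree_aut k\<^esub> spark w q"
proof (rule tree_aut_eqI)
  have pq: "p \<otimes>\<^bsub>BijGroup {..<k}\<^esub> q \<in> G" using p subgroup.m_closed[OF subgroup_base] by blast
  note t = wreath_tree_aut[OF spark_closed]
  show "spark w (p \<otimes>\<^bsub>BijGroup {..<k}\<^esub> q) \<in> carrier (tree_aut k)"
    "spark w p \<otimes>\<^bsub>tree_aut k\<^esub> spark w q \<in> carrier (tree_aut k)"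
    using t[OF pq] t[OF p(1)] t[OF p(2)] by auto
  fix v assume v: "v \<in> words k"
  have bij: "bij_betw (spark w q) (words k) (words k)" by (rule tree_aut_bij[OF t[OF p(2)]])
  \<comment> \<open>The left factor is evaluated at \<open>spark w q v\<close>. Since
    \<open>spark w q\<close> fixes \<open>w\<close> and is injective, the label of the left factor
    at \<open>w\<close> is met only for \<open>v = w\<close>.\<close>
  have "spark w q v = w \<longleftrightarrow> v = w"
    using spark_fixes[OF p(2) w, of w] inj_on_eq_iff[OF bij_betw_imp_inj_on[OF bij] v w] by simp
  then show "local_perm k (spark w (p \<otimes>\<^bsub>BijGroup {..<k}\<^esub> q)) v =
      local_perm k (spark w p \<otimes>\<^bsub>tree_aut k\<^esub> spark w q) v"
    using v tree_aut_words[OF t[OF p(2)] v]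
    by (simp add: local_perm_mult t p pq local_perm_spark)
qed

text \<open>For fixed \<open>w\<close>, \<open>spark w\<close> is a homomorphism from
  \<open>G\<close>, and homomorphisms carry derived subgroups into derived subgroups.\<close>

lemma spark_derived:
  assumes p: "p \<in> derived base (carrier base)" and w: "w \<in> words k"
  shows "spark w p \<in> derived (wreath k G) (carrier (wreath k G))"
proof -
  interpret sp: group_hom base "wreath k G" "spark w"
    by (intro group_hom.intro group_hom_axioms.intro wreath.group_axioms base.group_axioms homI)
      (simp_all add: spark_closed spark_mult w)
  have "spark w p \<in> derived (wreath k G) (spark w ` carrier base)"
    unfolding sp.derived_img[OF subset_refl] using p by blast
  also have "\<dots> \<subseteq> derived (wreath k G) (carrier (wreath k G))"
    by (rule wreath.mono_derived) (auto simp: spark_closed)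
  finally show ?thesis .
qed

text \<open>Once the prefix has been moved to \<open>v'\<close>, the last letter is corrected by a
  spark at \<open>v'\<close>, which leaves \<open>v'\<close> itself fixed. Transitivity of
  \<open>G\<close> provides its label.\<close>

lemma wreath_transitive_on_level:
  "u \<in> words k \<Longrightarrow> v \<in> words k \<Longrightarrow> length u = length v \<Longrightarrow> \<exists>x\<in>carrier (wreath k G). x u = v"
proof (induction u arbitrary: v rule: rev_induct)
  case Nil
  then show ?case using wreath.one_closed by (intro bexI[of _ "\<one>\<^bsub>tree_aut k\<^esub>"]) (auto simp: one_tree_aut)
next
  case (snoc a u)
  obtain v' c where v: "v = v' @ [c]" using snoc.prems(3) by (cases v rule: rev_cases) auto
  have w: "u \<in> words k" "a < k" "v' \<in> words k" "c < k" "length u = length v'"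
    using snoc.prems v by auto
  obtain x where x: "x \<in> carrier (wreath k G)" "x u = v'" using snoc.IH[of v'] w by blast
  note xt = wreath_tree_aut[OF x(1)]
  define b where "b = local_perm k x u a"
  have b: "b < k" "x (u @ [a]) = v' @ [b]"
    using local_perm_less[OF xt w(1,2)] tree_aut_snoc_local_perm[OF xt w(1,2)] x(2) by (simp_all add: b_def)
  obtain p where p: "p \<in> G" "p b = c"
    using perm_group b w(4) unfolding transitive_perm_group_def by blast
  note s = spark_closed[OF p(1), of v']
  note st = wreath_tree_aut[OF s]
  have "spark v' p (v' @ [b]) = v' @ [c]"
    using tree_aut_snoc_local_perm[OF st w(3) b(1)] by (simp add: spark_fixes local_perm_spark p w)
  then have "(spark v' p \<otimes>\<^bsub>tree_aut k\<^esub> x) (u @ [a]) = v"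
    using w by (simp add: mult_tree_aut_apply[OF st xt] b v)
  then show ?case using wreath.m_closed[OF s x(1)] by (intro bexI) auto
qed

section \<open>Approximation by derived elements on each level\<close>

lemma level_nonempty: "k > 0 \<Longrightarrow> replicate n 0 \<in> level k n"
  by (simp add: level_def lists_eq_set subset_iff)

lemma spark_level: "p \<in> G \<Longrightarrow> w \<in> level k n \<Longrightarrow> u \<in> level k n \<Longrightarrow> spark w p u = u"
  by (simp add: level_def spark_fixes)

lemma inv_tree_apply:
  assumes "f \<in> carrier (tree_aut k)" "w \<in> words k"
  shows "(inv\<^bsub>tree_aut k\<^esub> f) (f w) = w" "f ((inv\<^bsub>tree_aut k\<^esub> f) w) = w"
proof -
  have i: "inv\<^bsub>tree_aut k\<^esub> f \<in> carrier (tree_aut k)" using assms by simp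
  show "(inv\<^bsub>tree_aut k\<^esub> f) (f w) = w"
    using mult_tree_aut_apply[OF i assms(1,2)] assms by (simp add: one_tree_aut)
  show "f ((inv\<^bsub>tree_aut k\<^esub> f) w) = w"
    using mult_tree_aut_apply[OF assms(1) i assms(2)] assms by (simp add: one_tree_aut)
qed

text \<open>Modulo the next level, the commutator moves a local permutation from \<open>w\<close> to \<open>w0\<close>.\<close>

lemma commutator_transfer:
  assumes w: "w \<in> level k n" "w0 \<in> level k n" "w \<noteq> w0" and p: "p \<in> G"
  obtains c where "c \<in> derived (wreath k G) (carrier (wreath k G))"
    "\<And>u. u \<in> level k n \<Longrightarrow> c u = u"
    "local_perm k c w = inv\<^bsub>BijGroup {..<k}\<^esub> p"
    "\<And>v. v \<in> level k n \<Longrightarrow> v \<noteq> w \<Longrightarrow> v \<noteq> w0 \<Longrightarrow> local_perm k c v = \<one>\<^bsub>BijGroup {..<k}\<^esub>"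
proof -
  obtain x where x: "x \<in> carrier (wreath k G)" "x w = w0"
    using wreath_transitive_on_level[of w w0] w by (auto simp: level_def)
  define e where "e = spark w p"
  have e: "e \<in> carrier (wreath k G)" by (simp add: e_def spark_closed p)
  note xt = wreath_tree_aut[OF x(1)] and et = wreath_tree_aut[OF e]
  define ix where "ix = inv\<^bsub>tree_aut k\<^esub> x"
  define ie where "ie = inv\<^bsub>tree_aut k\<^esub> e"
  have ixt: "ix \<in> carrier (tree_aut k)" and iet: "ie \<in> carrier (tree_aut k)"
    using xt et by (simp_all add: ix_def ie_def)
  have ixw: "ix \<in> carrier (wreath k G)" and iew: "ie \<in> carrier (wreath k G)"
    using x(1) e wreath.inv_closed by (simp_all add: ix_def ie_def flip: inv_wreath)
  \<comment> \<open>Conjugation by \<open>x\<close> carries the label of \<open>e\<close> from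
    \<open>w\<close> to \<open>x w = w0\<close>, where it becomes a conjugate of \<open>p\<close>.
    The lemma leaves this label open, since only its class counts later.\<close>
  define y where "y = x \<otimes>\<^bsub>tree_aut k\<^esub> e \<otimes>\<^bsub>tree_aut k\<^esub> ix"
  have xe: "x \<otimes>\<^bsub>tree_aut k\<^esub> e \<in> carrier (tree_aut k)" and yt: "y \<in> carrier (tree_aut k)"
    using xt et ixt by (simp_all add: y_def)
  define c where "c = ie \<otimes>\<^bsub>tree_aut k\<^esub> y"
  have e_fix: "e u = u" if "u \<in> level k n" for u using spark_level[OF p w(1) that] by (simp add: e_def)
  have ie_fix: "ie u = u" if "u \<in> level k n" for u
    using inv_tree_apply(1)[OF et level_words[OF that]] e_fix[OF that] by (simp add: ie_def)
  have x_ix: "x (ix u) = u" if "u \<in> words k" for u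
    using inv_tree_apply(2)[OF xt that] by (simp add: ix_def)
  have y_fix: "y u = u" if "u \<in> level k n" for u
    using that tree_aut_level[OF ixt that] x_ix
    by (simp add: y_def mult_tree_aut_apply xe ixt xt et level_words e_fix)
  have lp_y: "local_perm k y v = \<one>\<^bsub>BijGroup {..<k}\<^esub>" if v: "v \<in> level k n" "v \<noteq> w0" for v
  proof -
    have v': "ix v \<in> level k n" by (rule tree_aut_level[OF ixt v(1)])
    have "ix v \<noteq> w" using x_ix[OF level_words[OF v(1)]] x(2) v(2) by auto
    then have "local_perm k e (ix v) = \<one>\<^bsub>BijGroup {..<k}\<^esub>"
      by (simp add: e_def local_perm_spark p level_words[OF v'])
    then have "local_perm k (x \<otimes>\<^bsub>tree_aut k\<^esub> e) (ix v) = local_perm k x (ix v)"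
      using local_perm_Bij[OF xt level_words[OF v']]
      by (simp add: local_perm_mult xt et level_words[OF v'] e_fix v' BijGroup_simps(1))
    \<comment> \<open>Where the label of \<open>e\<close> is trivial, inserting \<open>e\<close>
      changes nothing, so \<open>y\<close> has there the same label as the product of
      \<open>x\<close> with its inverse.\<close>
    then have "local_perm k y v = local_perm k (x \<otimes>\<^bsub>tree_aut k\<^esub> ix) v"
      by (simp add: y_def local_perm_mult xe xt ixt level_words[OF v(1)])
    then show ?thesis using xt by (simp add: ix_def local_perm_one level_words[OF v(1)])
  qed
  have lp_c: "local_perm k c v = inv\<^bsub>BijGroup {..<k}\<^esub> (local_perm k e v) \<otimes>\<^bsub>BijGroup {..<k}\<^esub> local_perm k y v"
    if "v \<in> level k n" for v
    using local_perm_inv[OF et level_words[OF that], folded ie_def]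
      local_perm_mult[OF iet yt level_words[OF that]]
    by (simp add: c_def y_fix[OF that] ie_fix[OF that])
  have pP: "p \<in> carrier (BijGroup {..<k})" using base_subset[OF p] by (simp add: BijGroup_simps(1))
  show thesis
  proof
    have "inv\<^bsub>wreath k G\<^esub> ie = e" using wreath.inv_inv[OF e] by (simp add: inv_wreath e ie_def)
    then have "c = ie \<otimes>\<^bsub>wreath k G\<^esub> x \<otimes>\<^bsub>wreath k G\<^esub> inv\<^bsub>wreath k G\<^esub> ie \<otimes>\<^bsub>wreath k G\<^esub> inv\<^bsub>wreath k G\<^esub> x"
      using xt et ixt iet x(1) by (simp add: c_def y_def tree.m_assoc inv_wreath ix_def)
    then show "c \<in> derived (wreath k G) (carrier (wreath k G))"
      unfolding derived_def using iew x(1) by (blast intro: generate.incl)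
    show "c u = u" if "u \<in> level k n" for u
      using that by (simp add: c_def mult_tree_aut_apply iet yt level_words y_fix ie_fix)
    show "local_perm k c w = inv\<^bsub>BijGroup {..<k}\<^esub> p"
      using lp_c[OF w(1)] lp_y[OF w(1) w(3)] pP by (simp add: e_def local_perm_spark p level_words[OF w(1)])
    show "local_perm k c v = \<one>\<^bsub>BijGroup {..<k}\<^esub>" if "v \<in> level k n" "v \<noteq> w" "v \<noteq> w0" for v
      using lp_c[OF that(1)] lp_y[OF that(1,3)] that(2)
      by (simp add: e_def local_perm_spark p level_words[OF that(1)])
  qed
qed

text \<open>\<open>W\<close> collects the vertices other than \<open>w0\<close> whose labels may
  still be nontrivial. Multiplication by a commutator clears one of them at the expense of
  \<open>w0\<close> and keeps the level product. When none is left, the level product is the class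
  of the label at \<open>w0\<close>, which is therefore derived, and a spark with this label does
  the job.\<close>

lemma stabilizer_agrees_derived:
  assumes w0: "w0 \<in> level k n" and "finite W"
  shows "h \<in> carrier (wreath k G) \<Longrightarrow> (\<And>u. u \<in> level k n \<Longrightarrow> h u = u) \<Longrightarrow>
    level_sum n h = \<one>\<^bsub>base_ab\<^esub> \<Longrightarrow>
    (\<And>w. w \<in> level k n \<Longrightarrow> w \<noteq> w0 \<Longrightarrow> w \<notin> W \<Longrightarrow> local_perm k h w = \<one>\<^bsub>BijGroup {..<k}\<^esub>) \<Longrightarrow>
    \<exists>d\<in>derived (wreath k G) (carrier (wreath k G)). \<forall>u\<in>level k (Suc n). d u = h u"
  using \<open>finite W\<close>
proof (induction W arbitrary: h rule: finite_induct)
  case empty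
  define q where "q = local_perm k h w0"
  have q: "q \<in> G" using local_perm_wreath[OF empty(1)] level_words[OF w0] by (simp add: q_def)
  have "level_sum n h = finprod base_ab (\<lambda>w. if w = w0 then base_class q else \<one>\<^bsub>base_ab\<^esub>) (level k n)"
    unfolding level_sum_def using empty(4)
    by (intro base_ab.finprod_cong' refl funcsetI) (auto simp: q_def base_class_one)
  also have "\<dots> = base_class q"
    using base_ab.finprod_singleton_swap[OF w0 finite_level, of "\<lambda>_. base_class q"] by simp
  finally have "q \<in> derived base (carrier base)"
    using base_class_eq_one[OF q] empty(3) by simp
  then have d: "spark w0 q \<in> derived (wreath k G) (carrier (wreath k G))"
    by (rule spark_derived[OF _ level_words[OF w0]])
  have "spark w0 q u = h u" if u: "u \<in> level k (Suc n)" for u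
  proof -
    obtain w a where wa: "u = w @ [a]" "w \<in> level k n" "a < k"
      using u by (cases u rule: rev_cases) (auto simp: level_def)
    note ww = level_words[OF wa(2)]
    have "local_perm k (spark w0 q) w = local_perm k h w"
      using empty(4)[OF wa(2)]
      by (cases "w = w0") (simp_all add: local_perm_spark[OF q] ww level_words[OF w0], simp add: q_def)
    then show ?thesis
      using tree_aut_snoc_local_perm[OF wreath_tree_aut[OF empty(1)] ww wa(3)]
        tree_aut_snoc_local_perm[OF wreath_tree_aut[OF spark_closed[OF q]] ww wa(3)]
      by (simp add: wa(1) empty(2)[OF wa(2)] spark_level[OF q w0 wa(2)])
  qed
  with d show ?case by blast
next
  case (insert w W)
  show ?case
  proof (cases "w \<in> level k n \<and> w \<noteq> w0")
    case False
    then show ?thesis using insert.prems(4) by (intro insert.IH[OF insert.prems(1-3)]) auto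
  next
    case True
    define p where "p = local_perm k h w"
    have w: "w \<in> words k" using True level_words by blast
    have p: "p \<in> G" using local_perm_wreath[OF insert.prems(1) w] by (simp add: p_def)
    obtain c where c: "c \<in> derived (wreath k G) (carrier (wreath k G))"
      "\<And>u. u \<in> level k n \<Longrightarrow> c u = u"
      "local_perm k c w = inv\<^bsub>BijGroup {..<k}\<^esub> p"
      "\<And>v. v \<in> level k n \<Longrightarrow> v \<noteq> w \<Longrightarrow> v \<noteq> w0 \<Longrightarrow> local_perm k c v = \<one>\<^bsub>BijGroup {..<k}\<^esub>"
      using commutator_transfer[OF _ w0 _ p, of w] True by metis
    have cw: "c \<in> carrier (wreath k G)" using c(1) derived_wreath_subset by blast
    note ht = wreath_tree_aut[OF insert.prems(1)] and ct = wreath_tree_aut[OF cw]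
    \<comment> \<open>The label of \<open>c\<close> at \<open>w\<close> is the inverse of
      \<open>p\<close>, so \<open>h'\<close> is trivial there; vertices other than \<open>w\<close>
      and \<open>w0\<close> keep their labels because \<open>c\<close> is trivial at them and fixes
      the level.\<close>
    define h' where "h' = h \<otimes>\<^bsub>tree_aut k\<^esub> c"
    have h': "h' \<in> carrier (wreath k G)"
      using wreath.m_closed[OF insert.prems(1) cw] by (simp add: h'_def)
    have lp: "local_perm k h' v = local_perm k h v \<otimes>\<^bsub>BijGroup {..<k}\<^esub> local_perm k c v"
      if "v \<in> level k n" for v
      using that by (simp add: h'_def local_perm_mult ht ct level_words c(2))
    have "\<exists>d\<in>derived (wreath k G) (carrier (wreath k G)). \<forall>u\<in>level k (Suc n). d u = h' u"
    proof (rule insert.IH[OF h'])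
      show "h' u = u" if "u \<in> level k n" for u
        using that by (simp add: h'_def mult_tree_aut_apply ht ct level_words c(2) insert.prems(2))
      show "level_sum n h' = \<one>\<^bsub>base_ab\<^esub>"
        by (simp add: h'_def level_sum_mult insert.prems(1,3) cw level_sum_derived[OF c(1)])
      show "local_perm k h' v = \<one>\<^bsub>BijGroup {..<k}\<^esub>" if v: "v \<in> level k n" "v \<noteq> w0" "v \<notin> W" for v
      proof (cases "v = w")
        case True
        then show ?thesis
          using lp[OF v(1)] c(3) base_subset[OF p] by (simp add: p_def BijGroup_simps(1))
      qed (use v lp insert.prems(4) c(4) in auto)
    qed
    then obtain d where d: "d \<in> derived (wreath k G) (carrier (wreath k G))"
      "\<And>u. u \<in> level k (Suc n) \<Longrightarrow> d u = h' u" by blast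
    interpret D: subgroup "derived (wreath k G) (carrier (wreath k G))" "wreath k G"
      by (rule wreath.derived_is_subgroup) simp
    \<comment> \<open>Undoing \<open>c\<close> on the right may move \<open>u\<close> within level n
      + 1, so the agreement of \<open>d\<close> with \<open>h'\<close> is used at the moved
      word.\<close>
    have "(d \<otimes>\<^bsub>tree_aut k\<^esub> inv\<^bsub>tree_aut k\<^esub> c) u = h u" if u: "u \<in> level k (Suc n)" for u
    proof -
      have dt: "d \<in> carrier (tree_aut k)" using d(1) derived_wreath_subset wreath_tree_aut by blast
      have ic: "inv\<^bsub>tree_aut k\<^esub> c \<in> carrier (tree_aut k)" using ct by simp
      have v: "(inv\<^bsub>tree_aut k\<^esub> c) u \<in> level k (Suc n)" by (rule tree_aut_level[OF ic u])
      show ?thesis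
        using d(2)[OF v] inv_tree_apply(2)[OF ct level_words[OF u]]
        by (simp add: mult_tree_aut_apply dt ic ht ct level_words[OF u] level_words[OF v] h'_def)
    qed
    moreover have "d \<otimes>\<^bsub>tree_aut k\<^esub> inv\<^bsub>tree_aut k\<^esub> c \<in> derived (wreath k G) (carrier (wreath k G))"
      using D.m_closed[OF d(1) D.m_inv_closed[OF c(1)]] by (simp add: inv_wreath cw)
    ultimately show ?thesis by blast
  qed
qed

text \<open>If \<open>d\<close> agrees with \<open>h\<close> on level n, then the inverse of
  \<open>d\<close> times \<open>h\<close> fixes that level and still has trivial level products,
  since derived elements do. The stabilizer case yields \<open>d'\<close>, and \<open>d\<close>
  times \<open>d'\<close> is the next approximation.\<close>

lemma agrees_derived:
  assumes "k > 0" and h: "h \<in> carrier (wreath k G)" and one: "\<And>i. level_sum i h = \<one>\<^bsub>base_ab\<^esub>"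
  shows "\<exists>d\<in>derived (wreath k G) (carrier (wreath k G)). \<forall>u\<in>level k n. d u = h u"
proof (induction n)
  case 0
  have "\<one>\<^bsub>wreath k G\<^esub> \<in> derived (wreath k G) (carrier (wreath k G))"
    by (intro subgroup.one_closed wreath.derived_is_subgroup) simp
  then show ?case
    using tree_aut_Nil[OF wreath_tree_aut[OF h]]
    by (intro bexI[of _ "\<one>\<^bsub>wreath k G\<^esub>"]) (auto simp: level_def one_tree_aut)
next
  case (Suc n)
  then obtain d where d: "d \<in> derived (wreath k G) (carrier (wreath k G))" "\<And>u. u \<in> level k n \<Longrightarrow> d u = h u"
    by blast
  interpret D: subgroup "derived (wreath k G) (carrier (wreath k G))" "wreath k G"
    by (rule wreath.derived_is_subgroup) simp
  have dw: "d \<in> carrier (wreath k G)" using d(1) derived_wreath_subset by blast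
  note dt = wreath_tree_aut[OF dw] and ht = wreath_tree_aut[OF h]
  define i where "i = inv\<^bsub>tree_aut k\<^esub> d"
  have iD: "i \<in> derived (wreath k G) (carrier (wreath k G))"
    using D.m_inv_closed[OF d(1)] by (simp add: inv_wreath dw i_def)
  then have iw: "i \<in> carrier (wreath k G)" using derived_wreath_subset by blast
  note it = wreath_tree_aut[OF iw]
  have "\<exists>d'\<in>derived (wreath k G) (carrier (wreath k G)).
    \<forall>u\<in>level k (Suc n). d' u = (i \<otimes>\<^bsub>tree_aut k\<^esub> h) u"
  \<comment> \<open>With the whole level as \<open>W\<close>, the condition on labels outside
    \<open>W\<close> is vacuous.\<close>
  proof (rule stabilizer_agrees_derived[OF level_nonempty[OF \<open>k > 0\<close>] finite_level[of k n]])
    show "i \<otimes>\<^bsub>tree_aut k\<^esub> h \<in> carrier (wreath k G)" using wreath.m_closed[OF iw h] by simp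
    show "(i \<otimes>\<^bsub>tree_aut k\<^esub> h) u = u" if "u \<in> level k n" for u
      using inv_tree_apply(1)[OF dt level_words[OF that], folded i_def] d(2)[OF that]
      by (simp add: mult_tree_aut_apply it ht level_words[OF that])
    show "level_sum n (i \<otimes>\<^bsub>tree_aut k\<^esub> h) = \<one>\<^bsub>base_ab\<^esub>"
      by (simp add: level_sum_mult iw h one level_sum_derived[OF iD])
  qed blast
  then obtain d' where d': "d' \<in> derived (wreath k G) (carrier (wreath k G))"
    "\<And>u. u \<in> level k (Suc n) \<Longrightarrow> d' u = (i \<otimes>\<^bsub>tree_aut k\<^esub> h) u" by blast
  have d't: "d' \<in> carrier (tree_aut k)" using d'(1) derived_wreath_subset wreath_tree_aut by blast
  have "(d \<otimes>\<^bsub>tree_aut k\<^esub> d') u = h u" if u: "u \<in> level k (Suc n)" for u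
    using d'(2)[OF u] inv_tree_apply(2)[OF dt tree_aut_words[OF ht level_words[OF u]], folded i_def]
    by (simp add: mult_tree_aut_apply dt d't it ht level_words[OF u])
  moreover have "d \<otimes>\<^bsub>tree_aut k\<^esub> d' \<in> derived (wreath k G) (carrier (wreath k G))"
    using D.m_closed[OF d(1) d'(1)] by simp
  ultimately show ?case by blast
qed

section \<open>The topology and the closed commutator subgroup\<close>

lemma level_stab_eq: "level_stab k n = {f \<in> carrier (tree_aut k). \<forall>w\<in>level k n. f w = w}"
  by (auto simp: level_stab_def level_def)

lemma mem_coset_level_stab:
  assumes f: "f \<in> carrier (tree_aut k)"
  shows "g \<in> f <#\<^bsub>tree_aut k\<^esub> level_stab k n \<longleftrightarrow> g \<in> carrier (tree_aut k) \<and> (\<forall>w\<in>level k n. g w = f w)"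
proof
  assume "g \<in> f <#\<^bsub>tree_aut k\<^esub> level_stab k n"
  then show "g \<in> carrier (tree_aut k) \<and> (\<forall>w\<in>level k n. g w = f w)"
    using f by (auto simp: l_coset_def level_stab_eq mult_tree_aut_apply level_words)
next
  assume g: "g \<in> carrier (tree_aut k) \<and> (\<forall>w\<in>level k n. g w = f w)"
  let ?s = "inv\<^bsub>tree_aut k\<^esub> f \<otimes>\<^bsub>tree_aut k\<^esub> g"
  have "?s w = w" if "w \<in> level k n" for w
    using inv_tree_apply(1)[OF f level_words[OF that]] f g that by (simp add: mult_tree_aut_apply level_words)
  then have "?s \<in> level_stab k n" using f g by (simp add: level_stab_eq)
  moreover have "g = f \<otimes>\<^bsub>tree_aut k\<^esub> ?s" using f g by (simp flip: tree.m_assoc)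
  ultimately show "g \<in> f <#\<^bsub>tree_aut k\<^esub> level_stab k n" unfolding l_coset_def by blast
qed

lemma openin_tree_aut:
  "openin (tree_aut_topology k) U \<longleftrightarrow> U \<subseteq> carrier (tree_aut k) \<and>
     (\<forall>f\<in>U. \<exists>n. f <#\<^bsub>tree_aut k\<^esub> level_stab k n \<subseteq> U)"
  unfolding tree_aut_topology_def topology_inverse'[OF istopology_tree_aut] ..

lemma openin_coset_level_stab:
  assumes f: "f \<in> carrier (tree_aut k)"
  shows "openin (tree_aut_topology k) (f <#\<^bsub>tree_aut k\<^esub> level_stab k n)"
  unfolding openin_tree_aut
proof (intro conjI ballI exI[of _ n])
  show "f <#\<^bsub>tree_aut k\<^esub> level_stab k n \<subseteq> carrier (tree_aut k)"
    using mem_coset_level_stab[OF f] by blast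
  fix g assume "g \<in> f <#\<^bsub>tree_aut k\<^esub> level_stab k n"
  then show "g <#\<^bsub>tree_aut k\<^esub> level_stab k n \<subseteq> f <#\<^bsub>tree_aut k\<^esub> level_stab k n"
    using mem_coset_level_stab[OF f] mem_coset_level_stab[of g] by auto
qed

lemma topspace_tree_aut: "topspace (tree_aut_topology k) = carrier (tree_aut k)"
proof
  show "topspace (tree_aut_topology k) \<subseteq> carrier (tree_aut k)"
    using openin_tree_aut openin_topspace by blast
  show "carrier (tree_aut k) \<subseteq> topspace (tree_aut_topology k)"
    using openin_coset_level_stab mem_coset_level_stab openin_subset by blast
qed

lemma level_sum_cong:
  assumes f: "f \<in> carrier (tree_aut k)" and g: "g \<in> carrier (tree_aut k)"
    and eq: "\<And>w. w \<in> level k (Suc n) \<Longrightarrow> f w = g w"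
  shows "level_sum n f = level_sum n g"
proof -
  have "local_perm k f w = local_perm k g w" if "w \<in> level k n" for w
    using eq[of "w @ [_]"] that by (auto simp: local_perm_def level_def)
  then show ?thesis unfolding level_sum_def by (intro base_ab.finprod_cong' refl funcsetI) auto
qed

text \<open>Each level product depends on finitely many values and is thus locally constant, so
  triviality passes from the derived subgroup to its closure. Conversely,
  \<open>agrees_derived\<close> puts a derived element into every basic neighbourhood.\<close>

lemma wreath_commutator_eq:
  assumes "k > 0"
  shows "wreath_commutator k G = {h \<in> carrier (wreath k G). \<forall>n. level_sum n h = \<one>\<^bsub>base_ab\<^esub>}"
proof (rule subset_antisym; rule subsetI)
  fix h assume "h \<in> wreath_commutator k G"
  then have cl: "h \<in> topspace (wreath_topology k G) \<and> (\<forall>T. h \<in> T \<and> openin (wreath_topology k G) T \<longrightarrow>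
        (\<exists>d. d \<in> derived (wreath k G) (carrier (wreath k G)) \<and> d \<in> T))"
    unfolding wreath_commutator_def in_closure_of .
  then have h: "h \<in> carrier (wreath k G)" by (simp add: wreath_topology_def)
  note ht = wreath_tree_aut[OF h]
  have "level_sum n h = \<one>\<^bsub>base_ab\<^esub>" for n
  proof -
    \<comment> \<open>The neighbourhood is that of level n + 1: labels on level n are read from the
      images of their children.\<close>
    let ?T = "(h <#\<^bsub>tree_aut k\<^esub> level_stab k (Suc n)) \<inter> carrier (wreath k G)"
    have "openin (wreath_topology k G) ?T"
      unfolding wreath_topology_def openin_subtopology using openin_coset_level_stab[OF ht] by blast
    moreover have "h \<in> ?T" using h ht by (simp add: mem_coset_level_stab)
    ultimately obtain d where d: "d \<in> derived (wreath k G) (carrier (wreath k G))" "d \<in> ?T"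
      using spec[OF conjunct2[OF cl], of ?T] by metis
    then have "level_sum n d = level_sum n h"
      using ht by (intro level_sum_cong) (simp_all add: mem_coset_level_stab)
    then show ?thesis using level_sum_derived[OF d(1)] by simp
  qed
  with h show "h \<in> {h \<in> carrier (wreath k G). \<forall>n. level_sum n h = \<one>\<^bsub>base_ab\<^esub>}" by simp
next
  fix h assume "h \<in> {h \<in> carrier (wreath k G). \<forall>n. level_sum n h = \<one>\<^bsub>base_ab\<^esub>}"
  then have h: "h \<in> carrier (wreath k G)" "\<And>n. level_sum n h = \<one>\<^bsub>base_ab\<^esub>" by auto
  note ht = wreath_tree_aut[OF h(1)]
  show "h \<in> wreath_commutator k G"
    unfolding wreath_commutator_def in_closure_of
  proof (intro conjI allI impI)
    show "h \<in> topspace (wreath_topology k G)"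
      using h(1) ht by (simp add: wreath_topology_def topspace_tree_aut)
    fix T assume T: "h \<in> T \<and> openin (wreath_topology k G) T"
    then obtain U where U: "openin (tree_aut_topology k) U" "T = U \<inter> carrier (wreath k G)"
      unfolding wreath_topology_def openin_subtopology by blast
    then obtain n where n: "h <#\<^bsub>tree_aut k\<^esub> level_stab k n \<subseteq> U"
      using T unfolding openin_tree_aut by blast
    obtain d where d: "d \<in> derived (wreath k G) (carrier (wreath k G))" "\<And>u. u \<in> level k n \<Longrightarrow> d u = h u"
      using agrees_derived[OF assms h] by blast
    have dw: "d \<in> carrier (wreath k G)" using d(1) derived_wreath_subset by blast
    then have "d \<in> h <#\<^bsub>tree_aut k\<^esub> level_stab k n"
      using mem_coset_level_stab[OF ht] d(2) wreath_tree_aut by blast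
    then show "\<exists>y. y \<in> derived (wreath k G) (carrier (wreath k G)) \<and> y \<in> T"
      using d(1) dw n U(2) by blast
  qed
qed

text \<open>Each left coset is a joint fibre of all the homomorphisms \<open>level_sum n\<close>.
  Comparing fibres directly avoids a separate proof that the closure is a subgroup.\<close>

lemma coset_wreath_commutator_eq_iff:
  assumes "k > 0" and f: "f \<in> carrier (wreath k G)" and g: "g \<in> carrier (wreath k G)"
  shows "f <#\<^bsub>wreath k G\<^esub> wreath_commutator k G = g <#\<^bsub>wreath k G\<^esub> wreath_commutator k G \<longleftrightarrow>
    (\<forall>n. level_sum n f = level_sum n g)"
proof -
  note C = wreath_commutator_eq[OF \<open>k > 0\<close>]
  have coset: "x \<in> f <#\<^bsub>wreath k G\<^esub> wreath_commutator k G \<longleftrightarrow>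
      x \<in> carrier (wreath k G) \<and> (\<forall>n. level_sum n x = level_sum n f)"
    if f: "f \<in> carrier (wreath k G)" for f x
  proof
    assume "x \<in> f <#\<^bsub>wreath k G\<^esub> wreath_commutator k G"
    then show "x \<in> carrier (wreath k G) \<and> (\<forall>n. level_sum n x = level_sum n f)"
      using f wreath.m_closed[OF f] by (auto simp: l_coset_def C level_sum_mult level_sum_closed)
  next
    assume x: "x \<in> carrier (wreath k G) \<and> (\<forall>n. level_sum n x = level_sum n f)"
    let ?s = "inv\<^bsub>wreath k G\<^esub> f \<otimes>\<^bsub>wreath k G\<^esub> x"
    have s: "?s \<in> carrier (wreath k G)" and x_eq: "x = f \<otimes>\<^bsub>wreath k G\<^esub> ?s"
      using f x wreath.inv_solve_left' wreath.m_closed wreath.inv_closed by metis+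
    have "level_sum n ?s = \<one>\<^bsub>base_ab\<^esub>" for n
    proof -
      interpret group_hom "wreath k G" base_ab "level_sum n" by (rule group_hom_level_sum)
      have "level_sum n ?s = inv\<^bsub>base_ab\<^esub> level_sum n f \<otimes>\<^bsub>base_ab\<^esub> level_sum n x"
        using f x by (metis hom_inv hom_mult wreath.inv_closed)
      then show ?thesis using x level_sum_closed by simp
    qed
    then have "?s \<in> wreath_commutator k G" using s by (simp add: C)
    with x_eq show "x \<in> f <#\<^bsub>wreath k G\<^esub> wreath_commutator k G" unfolding l_coset_def by blast
  qed
  show ?thesis
  proof
    assume "f <#\<^bsub>wreath k G\<^esub> wreath_commutator k G = g <#\<^bsub>wreath k G\<^esub> wreath_commutator k G"
    then show "\<forall>n. level_sum n f = level_sum n g" using coset[OF f, of f] coset[OF g, of f] f by simp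
  next
    assume "\<forall>n. level_sum n f = level_sum n g"
    then show "f <#\<^bsub>wreath k G\<^esub> wreath_commutator k G = g <#\<^bsub>wreath k G\<^esub> wreath_commutator k G"
      by (simp add: set_eq_iff coset[OF f] coset[OF g])
  qed
qed

end

section \<open>Level products of automata\<close>

text \<open>Among the first \<open>card S + 1\<close> terms two coincide, say at
  \<open>i < j\<close>, and the recursion makes the sequence periodic from \<open>i\<close> on. An
  index not below \<open>card S\<close> is at least \<open>j\<close>, so replacing \<open>j\<close>
  by \<open>i\<close> in it lowers it without changing the value.\<close>

lemma orbit_finite_range:
  fixes x :: "nat \<Rightarrow> 'a"
  assumes step: "\<And>n. x (Suc n) = T (x n)" and mem: "\<And>n. x n \<in> S" and "finite S"
  shows "\<exists>i<card S. x i = x n"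
proof -
  have "\<not> inj_on x {..card S}"
  proof
    assume "inj_on x {..card S}"
    then have "card {..card S} \<le> card S"
      using mem \<open>finite S\<close> by (intro card_inj_on_le) auto
    then show False by simp
  qed
  then obtain i j where ij: "i < j" "j \<le> card S" "x i = x j"
    unfolding inj_on_def by (metis atMost_iff linorder_neqE_nat)
  have shift: "x (i + m) = x (j + m)" for m by (induction m) (simp_all add: ij(3) step)
  show ?thesis
  proof (induction n rule: less_induct)
    case (less n)
    show ?case
    proof (cases "n < card S")
      case False
      then have "x n = x (i + (n - j))" using shift[of "n - j"] ij by simp
      moreover have "i + (n - j) < n" using False ij by simp
      ultimately show ?thesis using less.IH by metis
    qed blast
  qed
qed

lemma run_snoc: "run A q (u @ [a]) = run A q u @ [out A (foldl (trans A) q u) a]"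
  by (induction u arbitrary: q) auto

lemma local_perm_computed:
  "w \<in> words k \<Longrightarrow> local_perm k (computed k A) w = restrict (out A (foldl (trans A) (init A) w)) {..<k}"
  by (auto simp: local_perm_def computed_def run_snoc)

lemma foldl_trans_states:
  "finite_initial_automaton k A \<Longrightarrow> q \<in> states A \<Longrightarrow> w \<in> words k \<Longrightarrow> foldl (trans A) q w \<in> states A"
  by (induction w arbitrary: q) (auto simp: finite_initial_automaton_def)

context transitive_wreath
begin

text \<open>The product is taken from an arbitrary state because the recurrence in \<open>n\<close>
  passes to successors. A state that the initial one does not reach may have outputs outside
  \<open>G\<close>; the default of \<open>base_class\<close> keeps the recurrence valid for
  it.\<close>

definition state_sum :: "nat automaton \<Rightarrow> nat \<Rightarrow> nat \<Rightarrow> (nat \<Rightarrow> nat) set" where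
  "state_sum A n q = finprod base_ab
     (\<lambda>w. base_class (restrict (out A (foldl (trans A) q w)) {..<k})) (level k n)"

lemma level_sum_computed: "level_sum n (computed k A) = state_sum A n (init A)"
  unfolding level_sum_def state_sum_def
  by (intro base_ab.finprod_cong' refl funcsetI) (simp_all add: local_perm_computed level_words)

lemma state_sum_closed: "state_sum A n q \<in> carrier base_ab"
  unfolding state_sum_def by (rule base_ab.finprod_closed) simp

lemma level_Suc: "level k (Suc n) = (\<Union>a<k. Cons a ` level k n)"
proof (rule Set.set_eqI, rule iffI)
  fix w assume "w \<in> level k (Suc n)"
  then show "w \<in> (\<Union>a<k. Cons a ` level k n)" by (cases w) (auto simp: level_def)
qed (auto simp: level_def)

text \<open>The words of length n + 1 are partitioned by their first letter \<open>a\<close>, after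
  which the run continues from the successor of \<open>q\<close> under \<open>a\<close>.\<close>

lemma state_sum_Suc: "state_sum A (Suc n) q = finprod base_ab (\<lambda>a. state_sum A n (trans A q a)) {..<k}"
proof -
  let ?c = "\<lambda>q w. base_class (restrict (out A (foldl (trans A) q w)) {..<k})"
  have "state_sum A (Suc n) q = finprod base_ab (\<lambda>a. finprod base_ab (?c q) (Cons a ` level k n)) {..<k}"
    unfolding state_sum_def level_Suc
    by (rule base_ab.finprod_UN_disjoint) (auto simp: finite_level pairwise_def disjnt_def)
  also have "\<dots> = finprod base_ab (\<lambda>a. state_sum A n (trans A q a)) {..<k}"
  proof (intro base_ab.finprod_cong' refl funcsetI state_sum_closed)
    fix a
    show "finprod base_ab (?c q) (Cons a ` level k n) = state_sum A n (trans A q a)"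
      unfolding state_sum_def by (subst base_ab.finprod_reindex) (simp_all add: inj_on_def)
  qed
  finally show ?thesis .
qed

lemma state_sum_eq_bounded:
  assumes A: "finite_initial_automaton k A" and B: "finite_initial_automaton k B"
    and eq: "\<And>n. n < card (carrier base_ab) ^ (card (states A) + card (states B)) \<Longrightarrow>
      state_sum A n (init A) = state_sum B n (init B)"
  shows "state_sum A n (init A) = state_sum B n (init B)"
proof -
  \<comment> \<open>Both automata share one sequence, so a single index \<open>i\<close> represents
    level \<open>n\<close> for both. Restriction to the states confines its terms to a finite
    set.\<close>
  define x where "x n = (restrict (state_sum A n) (states A), restrict (state_sum B n) (states B))" for n
  define S where "S = (states A \<rightarrow>\<^sub>E carrier base_ab) \<times> (states B \<rightarrow>\<^sub>E carrier base_ab)"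
  \<comment> \<open>Transitions on letters below \<open>k\<close> stay within the states, so the
    next term depends on the restricted functions only.\<close>
  define T where "T = (\<lambda>(F, F').
    (\<lambda>q\<in>states A. finprod base_ab (\<lambda>a. F (trans A q a)) {..<k},
     \<lambda>q\<in>states B. finprod base_ab (\<lambda>a. F' (trans B q a)) {..<k}))"
  have fin: "finite (states A)" "finite (states B)" "init A \<in> states A" "init B \<in> states B"
    using A B by (auto simp: finite_initial_automaton_def)
  have "x (Suc n) = T (x n)" for n
  proof -
    have "finprod base_ab (\<lambda>a. state_sum A n (trans A q a)) {..<k} =
        finprod base_ab (\<lambda>a. restrict (state_sum A n) (states A) (trans A q a)) {..<k}"
      if "finite_initial_automaton k A" "q \<in> states A" for A :: "nat automaton" and q
      using that by (intro base_ab.finprod_cong' refl funcsetI)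
        (auto simp: finite_initial_automaton_def state_sum_closed)
    then show ?thesis using A B by (auto simp: x_def T_def state_sum_Suc intro!: restrict_ext)
  qed
  moreover have "x n \<in> S" for n by (auto simp: x_def S_def state_sum_closed)
  moreover have "finite S" using fin by (auto simp: S_def finite_base_ab intro!: finite_PiE)
  moreover have "card S = card (carrier base_ab) ^ (card (states A) + card (states B))"
    using fin by (simp add: S_def card_cartesian_product card_PiE power_add)
  ultimately obtain i where i: "i < card (carrier base_ab) ^ (card (states A) + card (states B))" "x i = x n"
    using orbit_finite_range[of x T S n] by auto
  have "state_sum A i (init A) = state_sum A n (init A)" "state_sum B i (init B) = state_sum B n (init B)"
    using i(2) fin(3,4) by (auto simp: x_def dest: fun_cong[of _ _ "init A"] fun_cong[of _ _ "init B"])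
  with eq[OF i(1)] show ?thesis by simp
qed

end

section \<open>Reading an encoded automaton\<close>

text \<open>A nonempty list is coded by the successor of a pair, which explains
  \<open>c - 1\<close>. On the code 0 of the empty list, truncated subtraction gives
  \<open>prod_decode 0\<close>, so both head and tail become 0.\<close>

definition hd_code :: "nat \<Rightarrow> nat" where
  "hd_code c = fst (prod_decode (c - 1))"

definition tl_code :: "nat \<Rightarrow> nat" where
  "tl_code c = snd (prod_decode (c - 1))"

definition nth_code :: "nat \<Rightarrow> nat \<Rightarrow> nat" where
  "nth_code c i = hd_code (rec_nat c (\<lambda>_ y. tl_code y) i)"

lemma prod_decode_0: "prod_decode 0 = (0, 0)"
  by (simp add: prod_decode_def prod_decode_aux.simps)

lemma hd_code_list_encode: "hd_code (list_encode (x # xs)) = x"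
  and tl_code_list_encode: "tl_code (list_encode xs) = list_encode (tl xs)"
  by (cases xs; simp add: hd_code_def tl_code_def prod_decode_0)+

lemma hd_code_0: "hd_code 0 = 0"
  by (simp add: hd_code_def prod_decode_0)

lemma nth_code_list_encode: "nth_code (list_encode xs) i = (if i < length xs then xs ! i else 0)"
proof -
  have "rec_nat (list_encode xs) (\<lambda>_ y. tl_code y) i = list_encode (drop i xs)"
    by (induction i) (simp_all add: tl_code_list_encode tl_drop drop_Suc)
  moreover have "drop i xs = xs ! i # drop (Suc i) xs" if "i < length xs"
    using that by (simp add: Cons_nth_drop_Suc)
  ultimately show ?thesis
    by (auto simp: nth_code_def hd_code_list_encode hd_code_0 simp del: list_encode.simps(2))
qed

lemma length_le_list_encode: "length xs \<le> list_encode xs"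
  by (induction xs) (auto intro: order_trans le_prod_encode_2)

text \<open>Positions past the end of the list decode to \<open>0\<close>, so they contribute nothing to the sum.\<close>

definition lookup :: "nat \<Rightarrow> nat \<Rightarrow> nat \<Rightarrow> nat \<Rightarrow> nat" where
  "lookup c j q a = (\<Sum>i<c. of_bool (nth_code (nth_code (tl_code c) i) 0 = q \<and>
     nth_code (nth_code (tl_code c) i) 1 = a) * nth_code (nth_code (tl_code c) i) j)"

text \<open>Each pair \<open>(q, a)\<close> heads exactly one entry of the list, so the sum has one
  relevant term; it is within range because a list is never longer than its code.\<close>

lemma lookup_encode_automaton:
  assumes A: "finite_initial_automaton k A" and q: "q \<in> states A" "a < k"
  shows "lookup (encode_automaton k A) 2 q a = trans A q a"
    and "lookup (encode_automaton k A) 3 q a = out A q a"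
proof -
  define L where "L = List.product (sorted_list_of_set (states A)) [0..<k]"
  define f where "f = (\<lambda>(q, a). [q, a, trans A q a, out A q a])"
  define c where "c = encode_automaton k A"
  have c: "c = list_encode (init A # map (\<lambda>x. list_encode (f x)) L)"
    unfolding c_def encode_automaton_def L_def f_def by (simp add: case_prod_unfold)
  have entry: "nth_code (tl_code c) i = (if i < length L then list_encode (f (L ! i)) else 0)" for i
    by (simp add: c tl_code_list_encode nth_code_list_encode del: list_encode.simps)
  have zero: "nth_code 0 j = 0" for j using nth_code_list_encode[of "[]" j] by simp
  have "finite (states A)" using A by (simp add: finite_initial_automaton_def)
  then have "(q, a) \<in> set L" using q by (simp add: L_def)
  then obtain i0 where i0: "i0 < length L" "L ! i0 = (q, a)" by (metis in_set_conv_nth)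
  have "distinct L" by (simp add: L_def distinct_product)
  then have uniq: "L ! i = (q, a) \<longleftrightarrow> i = i0" if "i < length L" for i
    using i0 that by (metis nth_eq_iff_index_eq)
  have "length L \<le> c" using length_le_list_encode[of "init A # map (\<lambda>x. list_encode (f x)) L"] by (simp add: c)
  have "lookup c j q a = f (q, a) ! j" if j: "j < 4" for j
  proof -
    have "of_bool (nth_code (nth_code (tl_code c) i) 0 = q \<and> nth_code (nth_code (tl_code c) i) 1 = a) *
        nth_code (nth_code (tl_code c) i) j = (if i = i0 then f (q, a) ! j else 0)" for i
    proof (cases "i < length L")
      case True
      obtain q' a' where qa: "L ! i = (q', a')" by fastforce
      show ?thesis using True uniq[OF True] j
        by (auto simp: entry nth_code_list_encode qa f_def simp del: list_encode.simps)
    qed (use i0(1) in \<open>simp add: entry zero\<close>)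
    then show ?thesis using i0(1) \<open>length L \<le> c\<close> by (simp add: lookup_def)
  qed
  from this[of 2] this[of 3] show "lookup (encode_automaton k A) 2 q a = trans A q a"
    "lookup (encode_automaton k A) 3 q a = out A q a"
    by (simp_all add: f_def c_def)
qed

text \<open>The list has at least one entry per state. This makes the code usable in place of the
  number of states in the search bound.\<close>

lemma card_states_le_encode_automaton:
  assumes "k > 0"
  shows "card (states A) \<le> encode_automaton k A"
proof -
  have "card (states A) \<le> Suc (card (states A) * k)"
    using assms mult_le_mono2[of 1 k "card (states A)"] by linarith
  also have "\<dots> \<le> encode_automaton k A"
    unfolding encode_automaton_def by (rule order_trans[OF _ length_le_list_encode]) simp
  finally show ?thesis .
qed

text \<open>The lowest \<open>n\<close> digits of \<open>j\<close> in base \<open>k\<close>, least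
  significant first. Numbering the words in this way turns a product over a level into a loop over
  \<open>j < k ^ n\<close>.\<close>

definition digits_word :: "nat \<Rightarrow> nat \<Rightarrow> nat \<Rightarrow> nat list" where
  "digits_word k n j = map (\<lambda>i. j div k ^ i mod k) [0..<n]"

text \<open>The first \<open>n\<close> digits determine \<open>j\<close> modulo
  \<open>k ^ n\<close>, which gives injectivity; the level has \<open>k ^ n\<close> elements as
  well, so surjectivity follows by counting.\<close>

lemma bij_betw_digits_word:
  assumes "k > 0"
  shows "bij_betw (digits_word k n) {..<k ^ n} (level k n)"
proof -
  have mod_eq: "j mod k ^ n = j' mod k ^ n" if "digits_word k n j = digits_word k n j'" for j j'
    using that
  proof (induction n)
    case (Suc n)
    then show ?case
      by (simp add: digits_word_def mult.commute[of k] mod_mult2_eq)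
  qed simp
  have inj: "inj_on (digits_word k n) {..<k ^ n}"
    by (rule inj_onI) (use mod_eq in fastforce)
  have sub: "digits_word k n ` {..<k ^ n} \<subseteq> level k n"
    using assms by (auto simp: digits_word_def level_def lists_eq_set)
  have "card (level k n) = k ^ n"
    using card_lists_length_eq[of "{..<k}" n] by (simp add: level_def lists_eq_set)
  then have "digits_word k n ` {..<k ^ n} = level k n"
    using sub inj by (intro card_subset_eq finite_level) (simp_all add: card_image)
  with inj show ?thesis by (simp add: bij_betw_def)
qed

definition reach :: "nat \<Rightarrow> nat \<Rightarrow> nat \<Rightarrow> nat \<Rightarrow> nat" where
  "reach k c n j = rec_nat (hd_code c) (\<lambda>i q. lookup c 2 q (j div k ^ i mod k)) n"

lemma reach_encode_automaton:
  assumes "k > 0" and A: "finite_initial_automaton k A"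
  shows "reach k (encode_automaton k A) n j = foldl (trans A) (init A) (digits_word k n j)"
proof (induction n)
  case 0
  show ?case
    by (simp add: reach_def digits_word_def encode_automaton_def hd_code_list_encode del: list_encode.simps)
next
  case (Suc n)
  have "digits_word k n j \<in> words k"
    using assms(1) by (auto simp: digits_word_def lists_eq_set)
  then have "foldl (trans A) (init A) (digits_word k n j) \<in> states A"
    using A by (intro foldl_trans_states[OF A]) (simp_all add: finite_initial_automaton_def)
  then show ?case
    using Suc assms by (simp add: reach_def digits_word_def lookup_encode_automaton)
qed

text \<open>The step is the coded list constructor. Each new value goes to the front, so the row of
  outputs is coded in reverse.\<close>

definition out_code :: "nat \<Rightarrow> nat \<Rightarrow> nat \<Rightarrow> nat" where
  "out_code k c q = rec_nat 0 (\<lambda>a y. Suc (prod_encode (lookup c 3 q a, y))) k"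

lemma out_code_encode_automaton:
  assumes "finite_initial_automaton k A" "q \<in> states A"
  shows "out_code k (encode_automaton k A) q = list_encode (rev (map (out A q) [0..<k]))"
proof -
  have "rec_nat 0 (\<lambda>a y. Suc (prod_encode (lookup (encode_automaton k A) 3 q a, y))) m =
      list_encode (rev (map (out A q) [0..<m]))" if "m \<le> k" for m
    using that by (induction m) (simp_all add: lookup_encode_automaton[OF assms])
  then show ?thesis by (simp add: out_code_def)
qed

lemma computable_nth_code [computable_intros]:
  assumes "computable n f" "computable n g"
  shows "computable n (\<lambda>xs. nth_code (f xs) (g xs))"
  unfolding nth_code_def hd_code_def tl_code_def by (rule computable_intros assms)+

lemma computable_lookup [computable_intros]:
  assumes "computable n c" "computable n q" "computable n a"
  shows "computable n (\<lambda>xs. lookup (c xs) j (q xs) (a xs))"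
  unfolding lookup_def tl_code_def by (rule computable_intros assms)+

lemma computable_reach [computable_intros]:
  assumes "computable n c" "computable n m" "computable n j"
  shows "computable n (\<lambda>xs. reach k (c xs) (m xs) (j xs))"
  unfolding reach_def hd_code_def by (rule computable_intros assms)+

lemma computable_out_code [computable_intros]:
  assumes "computable n c" "computable n q"
  shows "computable n (\<lambda>xs. out_code k (c xs) (q xs))"
  unfolding out_code_def by (rule computable_intros assms)+

section \<open>Computing level products from the code\<close>

context transitive_wreath
begin

text \<open>An arbitrary injective numbering of the finite group suffices: it is used only through a
  finite table and a constant.\<close>

definition class_code :: "(nat \<Rightarrow> nat) set \<Rightarrow> nat" where
  "class_code = to_nat_on (carrier base_ab)"

text \<open>Multiplies a class by the class of a local permutation, the latter given as a reversed
  row of outputs. Membership in \<open>level k k\<close> says that the row has length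
  \<open>k\<close> and entries below \<open>k\<close>; the value 0 elsewhere gives finite
  support.\<close>

definition step_table :: "nat \<Rightarrow> nat" where
  "step_table m = (case prod_decode m of (y, t) \<Rightarrow>
     if y \<in> class_code ` carrier base_ab \<and> list_decode t \<in> level k k
     then class_code (from_nat_into (carrier base_ab) y \<otimes>\<^bsub>base_ab\<^esub>
       base_class (\<lambda>a\<in>{..<k}. rev (list_decode t) ! a))
     else 0)"

definition sum_code :: "nat \<Rightarrow> nat \<Rightarrow> nat" where
  "sum_code c n = rec_nat (class_code \<one>\<^bsub>base_ab\<^esub>)
     (\<lambda>j y. step_table (prod_encode (y, out_code k c (reach k c n j)))) (k ^ n)"

lemma class_code_eq_iff:
  "x \<in> carrier base_ab \<Longrightarrow> y \<in> carrier base_ab \<Longrightarrow> class_code x = class_code y \<longleftrightarrow> x = y"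
  unfolding class_code_def
  using to_nat_on_inj[OF countable_finite[OF finite_base_ab]] by simp

lemma step_table_eq:
  assumes "x \<in> carrier base_ab" "\<And>a. a < k \<Longrightarrow> p a < k"
  shows "step_table (prod_encode (class_code x, list_encode (rev (map p [0..<k])))) =
    class_code (x \<otimes>\<^bsub>base_ab\<^esub> base_class (restrict p {..<k}))"
proof -
  have "from_nat_into (carrier base_ab) (class_code x) = x"
    unfolding class_code_def by (rule from_nat_into_to_nat_on[OF countable_finite[OF finite_base_ab] assms(1)])
  moreover have "(\<lambda>a\<in>{..<k}. map p [0..<k] ! a) = restrict p {..<k}" by (intro restrict_ext) simp
  moreover have "rev (map p [0..<k]) \<in> level k k" using assms(2) by (auto simp: level_def lists_eq_set)
  ultimately show ?thesis using assms(1) by (simp add: step_table_def)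
qed

lemma finite_step_table: "finite {m. step_table m \<noteq> 0}"
proof (rule finite_subset)
  show "{m. step_table m \<noteq> 0} \<subseteq>
    prod_encode ` (class_code ` carrier base_ab \<times> list_encode ` level k k)"
  proof
    fix m assume m: "m \<in> {m. step_table m \<noteq> 0}"
    obtain y t where yt: "prod_decode m = (y, t)" by fastforce
    with m have "y \<in> class_code ` carrier base_ab" "list_decode t \<in> level k k"
      by (auto simp: step_table_def split: if_splits)
    moreover have "t = list_encode (list_decode t)" "m = prod_encode (y, t)"
      using yt by (simp, metis prod_decode_inverse)
    ultimately show "m \<in> prod_encode ` (class_code ` carrier base_ab \<times> list_encode ` level k k)" by blast
  qed
qed (simp add: finite_base_ab finite_level)

lemma sum_code_encode_automaton:
  assumes "k > 0" and A: "finite_initial_automaton k A"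
  shows "sum_code (encode_automaton k A) n = class_code (level_sum n (computed k A))"
proof -
  let ?q = "\<lambda>j. foldl (trans A) (init A) (digits_word k n j)"
  define c where "c q = base_class (restrict (out A q) {..<k})" for q
  have c: "c q \<in> carrier base_ab" for q by (simp add: c_def)
  have q: "?q j \<in> states A" for j
    using A \<open>k > 0\<close> by (intro foldl_trans_states[OF A])
      (auto simp: finite_initial_automaton_def digits_word_def lists_eq_set)
  then have out: "a < k \<Longrightarrow> out A (?q j) a < k" for a j
    using A by (auto simp: finite_initial_automaton_def)
  have step: "step_table (prod_encode (class_code x, list_encode (rev (map (out A (?q j)) [0..<k])))) =
      class_code (x \<otimes>\<^bsub>base_ab\<^esub> c (?q j))" if "x \<in> carrier base_ab" for x j
    unfolding c_def by (rule step_table_eq[OF that]) (rule out)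
  \<comment> \<open>Loop invariant: after \<open>m\<close> rounds the value codes the product over
    the first \<open>m\<close> vertices in the digit numbering.\<close>
  have "rec_nat (class_code \<one>\<^bsub>base_ab\<^esub>) (\<lambda>j y. step_table (prod_encode
      (y, out_code k (encode_automaton k A) (reach k (encode_automaton k A) n j)))) m =
    class_code (finprod base_ab (\<lambda>j. c (?q j)) {..<m})" for m
  proof (induction m)
    case (Suc m)
    then show ?case
      by (simp add: reach_encode_automaton assms out_code_encode_automaton q step c
          lessThan_Suc base_ab.m_comm)
  qed simp
  then have "sum_code (encode_automaton k A) n = class_code (finprod base_ab (\<lambda>j. c (?q j)) {..<k ^ n})"
    by (simp add: sum_code_def)
  also have "finprod base_ab (\<lambda>j. c (?q j)) {..<k ^ n} = state_sum A n (init A)"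
    using bij_betw_digits_word[OF \<open>k > 0\<close>, of n]
      base_ab.finprod_reindex[of "\<lambda>w. c (foldl (trans A) (init A) w)" "digits_word k n" "{..<k ^ n}"]
    by (simp add: state_sum_def bij_betw_def c c_def[symmetric])
  finally show ?thesis by (simp add: level_sum_computed)
qed

lemma computable_sum_code:
  assumes "computable n c" "computable n m"
  shows "computable n (\<lambda>xs. sum_code (c xs) (m xs))"
  unfolding sum_code_def
  by (rule computable_intros assms computable_finite_support[OF finite_step_table])+

end

theorem theorem4:
  fixes k :: nat and G :: "(nat \<Rightarrow> nat) set"
  assumes "k \<ge> 1" and "transitive_perm_group k G"
  shows "decidable_on
    {(A :: nat automaton, B :: nat automaton).
       finite_initial_automaton k A \<and> finite_initial_automaton k B \<and>
       computed k A \<in> carrier (wreath k G) \<and> computed k B \<in> carrier (wreath k G)}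
    (\<lambda>(A, B). [encode_automaton k A, encode_automaton k B])
    (\<lambda>(A, B). computed k A <#\<^bsub>wreath k G\<^esub> wreath_commutator k G =
              computed k B <#\<^bsub>wreath k G\<^esub> wreath_commutator k G)"
proof -
  interpret transitive_wreath k G using assms(2) by unfold_locales
  have k: "k > 0" using assms(1) by simp
  define C where "C = card (carrier base_ab)"
  have C: "C > 0" unfolding C_def using finite_base_ab base_ab.one_closed by (metis card_gt_0_iff empty_iff)
  \<comment> \<open>The codes replace the numbers of states in the exponent. Testing more levels
    than necessary is harmless, since equality requires all of them to agree.\<close>
  let ?alg = "\<lambda>xs :: nat list. of_bool (\<forall>n<C ^ (xs ! 0 + xs ! 1). sum_code (xs ! 0) n = sum_code (xs ! 1) n) :: nat"
  have arg: "computable 2 (\<lambda>xs. xs ! 0)" "computable 2 (\<lambda>xs. xs ! 1)"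
    by (rule computable_nth, simp)+
  have "computable 2 ?alg"
    by (rule computable_intros arg computable_sum_code)+
  then obtain r where r: "\<And>xs. length xs = 2 \<Longrightarrow> rec_eval r xs (?alg xs)"
    unfolding computable_def by blast
  show ?thesis
    unfolding decidable_on_def
  proof (intro exI[of _ r] ballI, clarify)
    fix A B :: "nat automaton"
    assume AB: "finite_initial_automaton k A" "finite_initial_automaton k B"
      "computed k A \<in> carrier (wreath k G)" "computed k B \<in> carrier (wreath k G)"
    let ?a = "encode_automaton k A" and ?b = "encode_automaton k B"
    have "C ^ (card (states A) + card (states B)) \<le> C ^ (?a + ?b)"
      using C k by (intro power_increasing add_mono card_states_le_encode_automaton) auto
    then have "(\<forall>n<C ^ (?a + ?b). state_sum A n (init A) = state_sum B n (init B)) \<longleftrightarrow>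
        (\<forall>n. state_sum A n (init A) = state_sum B n (init B))"
      using state_sum_eq_bounded[OF AB(1,2), folded C_def] by (meson order_less_le_trans)
    also have "\<dots> \<longleftrightarrow> computed k A <#\<^bsub>wreath k G\<^esub> wreath_commutator k G =
        computed k B <#\<^bsub>wreath k G\<^esub> wreath_commutator k G"
      by (simp add: coset_wreath_commutator_eq_iff[OF k AB(3,4)] level_sum_computed)
    finally have "?alg [?a, ?b] = (if computed k A <#\<^bsub>wreath k G\<^esub> wreath_commutator k G =
        computed k B <#\<^bsub>wreath k G\<^esub> wreath_commutator k G then 1 else 0)"
      by (simp add: sum_code_encode_automaton k AB class_code_eq_iff level_sum_closed level_sum_computed
          state_sum_closed)
    with r[of "[?a, ?b]"] show "rec_eval r [?a, ?b] (if computed k A <#\<^bsub>wreath k G\<^esub> wreath_commutator k G =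
        computed k B <#\<^bsub>wreath k G\<^esub> wreath_commutator k G then 1 else 0)"
      by simp
  qed
qed

end
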